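(* Let $\beta$ be the discrete inf-sup constant of the pair $\mathbf V_0\times Q_0$. If $q\in\tilde Q_E$, then there exists $\mathbf v\in\tilde{\mathbf V}_E$ such that $\operatorname{div}\mathbf v=q$ and $$|\mathbf v|_{\mathbf H^1(\Omega)}\le\beta^{-1}\|q\|_{L^2(\Omega)}.$$ Consequently, the spaces $\tilde{\mathbf V}_E\times\tilde Q_E$ are uniformly inf-sup stable: $$\inf_{0\ne q\in\tilde Q_E}\ \sup_{\mathbf 0\ne\mathbf v\in\tilde{\mathbf V}_E}\frac{b(\mathbf v,q)}{|\mathbf v|_{\mathbf H^1(\Omega)}\|q\|_{L^2(\Omega)}}\ge\beta.$$
   Context: $\Omega\subset\mathbb R^2$ is a simply connected (bounded, open) polygon with boundary $\Gamma$. $\mathcal T$ is a partition of $\Omega$ into triangles such that the nonempty intersection of two distinct elements is a single common vertex or a single common edge of both, and $\rho_K\ge\kappa h_K$ for all $K\in\mathcal T$ ($h_K=\mathrm{diam}(K)$, $\rho_K$ the diameter of the largest inscribed circle, $\kappa>0$ independent of $\mathcal T$); $h=\max_Kh_K$. A corner vertex is an element vertex located at a vertex of the polygon $\Omega$; $\mathcal V_K$ is the set of vertices of $K$. $k\ge4$; $\mathcal P_m$ is the space of polynomials of total degree $\le m$. A piecewise polynomial is $C^r$ at a vertex if the derivatives of order $\le r$ of all its element restrictions at that vertex agree. $V=\{v\in H^1(\Omega): v|_K\in\mathcal P_k(K)\ \forall K,\ v\ C^1\text{ at noncorner vertices}\}$, $Q=\{q\in L^2(\Omega): q|_K\in\mathcal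 P_{k-1}(K)\ \forall K,\ q\ C^0\text{ at noncorner vertices}\}$, $V_0=V\cap H^1_0(\Omega)$, $\mathbf V_0=V_0\times V_0$, $Q_0=Q\cap L^2_0(\Omega)$ ($L^2_0$: zero mean), $\Sigma_0=\{\phi\in H^2_0(\Omega):\phi|_K\in\mathcal P_{k+1}(K)\ \forall K,\ \phi\ C^2\text{ at noncorner vertices}\}$. $\operatorname{curl}\phi=(\partial_y\phi,-\partial_x\phi)^T$, $(\cdot,\cdot)$ is the $L^2(\Omega)$ inner product, $a(\mathbf u,\mathbf v)=(\nabla\mathbf u,\nabla\mathbf v)$, $b(\mathbf v,p)=-(\operatorname{div}\mathbf v,p)$. $\Sigma_I=\{\phi\in\Sigma_0:\phi|_{\partial K}=\partial_n\phi|_{\partial K}=0\ \forall K\}$, $Q_I=\{q\in Q_0:\int_Kq\,dx=0,\ q|_K(a)=0\ \forall a\in\mathcal V_K,\ \forall K\}$, $\tilde Q_E=\{q\in Q_0:(q,r)=0\ \forall r\in Q_I\}$, $\tilde{\mathbf V}_E=\{\mathbf v\in\mathbf V_0:\operatorname{div}\mathbf v\in\tilde Q_E,\ a(\mathbf v,\operatorname{curl}\psi)=0\ \forall\psi\in\Sigma_I\}$. Inf-sup constant: the mesh is corner-split (roughly: every element has at most one edge on $\Gamma$), so that (known result) there is $\beta\in(0,1)$, independent of $h$ and $k$, such that for every $q\in Q_0$ there is $\mathbf v\in\mathbf V_0$ with $\operatorname{div}\mathbf v=q$ and $\|\mathbf v\|_{\mathbf H^1(\Omega)}\le\beta^{-1}\|q\|_{L^2(\Omega)}$.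 $\beta$ denotes this constant. *)

theory Defs
  imports "HOL-Analysis.Analysis"
begin

type_synonym pt = "real^2"
type_synonym scalar_fun = "pt \<Rightarrow> real"
type_synonym vector_fun = "pt \<Rightarrow> pt"

section \<open>Polygons and triangular meshes\<close>

definition polygon_edge :: "pt list \<Rightarrow> nat \<Rightarrow> pt set" where
  "polygon_edge cs i = closed_segment (cs ! i) (cs ! (Suc i mod length cs))"

definition polygon_boundary :: "pt list \<Rightarrow> pt set" where
  "polygon_boundary cs = (\<Union>i<length cs. polygon_edge cs i)"

text \<open>The list \<open>cs\<close> enumerates the corners in cyclic order. Consecutive triples are required not
  to be collinear, so that \<open>set cs\<close> consists of the genuine vertices of the polygon, i.e. it is
  determined by the domain.\<close>

definition simple_polygon :: "pt list \<Rightarrow> bool" where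
  "simple_polygon cs \<longleftrightarrow>
     length cs \<ge> 3 \<and> distinct cs \<and>
     (\<forall>i<length cs. \<not> collinear {cs ! i, cs ! (Suc i mod length cs),
                                  cs ! (Suc (Suc i) mod length cs)}) \<and>
     (\<forall>i j. i < j \<and> j < length cs \<longrightarrow>
        polygon_edge cs i \<inter> polygon_edge cs j =
          (if j = Suc i then {cs ! j}
           else if i = 0 \<and> Suc j = length cs then {cs ! 0}
           else {}))"

definition polygonal_domain :: "pt list \<Rightarrow> pt set \<Rightarrow> bool" where
  "polygonal_domain cs \<Omega> \<longleftrightarrow>
     simple_polygon cs \<and> \<Omega> = inside (polygon_boundary cs) \<and>
     open \<Omega> \<and> bounded \<Omega> \<and> simply_connected \<Omega>"

definition verts :: "pt set \<Rightarrow> pt set" where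
  "verts K = {a. a extreme_point_of K}"

text \<open>Elements are closed triangles (nondegenerate, by \<^term>\<open>2 simplex K\<close>).\<close>

definition conforming_mesh :: "pt set \<Rightarrow> pt set set \<Rightarrow> bool" where
  "conforming_mesh \<Omega> \<T> \<longleftrightarrow>
     finite \<T> \<and> (\<forall>K\<in>\<T>. 2 simplex K) \<and> \<Union>\<T> = closure \<Omega> \<and>
     (\<forall>K\<in>\<T>. \<forall>L\<in>\<T>. K \<noteq> L \<longrightarrow>
        K \<inter> L = {} \<or>
        (\<exists>a. K \<inter> L = {a} \<and> a \<in> verts K \<and> a \<in> verts L) \<or>
        (K \<inter> L edge_of K \<and> K \<inter> L edge_of L))"

definition inscribed_diameter :: "pt set \<Rightarrow> real" where
  "inscribed_diameter K = (SUP r\<in>{r. r > 0 \<and> (\<exists>c. cball c r \<subseteq> K)}. 2 * r)"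

definition shape_regular :: "real \<Rightarrow> pt set set \<Rightarrow> bool" where
  "shape_regular \<kappa> \<T> \<longleftrightarrow> (\<forall>K\<in>\<T>. inscribed_diameter K \<ge> \<kappa> * diameter K)"

definition corner_split :: "pt set \<Rightarrow> pt set set \<Rightarrow> bool" where
  "corner_split \<Omega> \<T> \<longleftrightarrow>
     (\<forall>K\<in>\<T>. \<forall>e e'. e edge_of K \<and> e \<subseteq> frontier \<Omega> \<and> e' edge_of K \<and> e' \<subseteq> frontier \<Omega>
        \<longrightarrow> e = e')"

definition noncorner_vertices :: "pt list \<Rightarrow> pt set set \<Rightarrow> pt set" where
  "noncorner_vertices cs \<T> = (\<Union>K\<in>\<T>. verts K) - set cs"

section \<open>Lebesgue and Sobolev spaces\<close>

text \<open>Elements of the function spaces are represented by functions on the whole plane of which only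
  the values almost everywhere in \<open>\<Omega>\<close> matter: all spaces below are closed under modification
  on null sets, and equality of two elements is equality almost everywhere in \<open>\<Omega>\<close>.\<close>

definition ae_eq :: "pt set \<Rightarrow> scalar_fun \<Rightarrow> scalar_fun \<Rightarrow> bool" where
  "ae_eq S f g \<longleftrightarrow> (AE x in lebesgue_on S. f x = g x)"

definition L2 :: "pt set \<Rightarrow> scalar_fun set" where
  "L2 \<Omega> = {f. f \<in> borel_measurable (lebesgue_on \<Omega>) \<and> integrable (lebesgue_on \<Omega>) (\<lambda>x. (f x)\<^sup>2)}"

definition L2_inner :: "pt set \<Rightarrow> scalar_fun \<Rightarrow> scalar_fun \<Rightarrow> real" where
  "L2_inner \<Omega> f g = (LINT x|lebesgue_on \<Omega>. f x * g x)"

definition L2_norm :: "pt set \<Rightarrow> scalar_fun \<Rightarrow> real" where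
  "L2_norm \<Omega> f = sqrt (L2_inner \<Omega> f f)"

definition L2_0 :: "pt set \<Rightarrow> scalar_fun set" where
  "L2_0 \<Omega> = {q \<in> L2 \<Omega>. (LINT x|lebesgue_on \<Omega>. q x) = 0}"

text \<open>Classical partial derivative in the \<open>i\<close>-th coordinate direction.\<close>

definition pd :: "2 \<Rightarrow> scalar_fun \<Rightarrow> scalar_fun" where
  "pd i f = (\<lambda>x. frechet_derivative f (at x) (axis i 1))"

definition smooth :: "scalar_fun \<Rightarrow> bool" where
  "smooth f \<longleftrightarrow> (\<forall>is. foldr pd is f differentiable_on UNIV)"

definition test_functions :: "pt set \<Rightarrow> scalar_fun set" where
  "test_functions \<Omega> =
     {\<phi>. smooth \<phi> \<and> compact (closure {x. \<phi> x \<noteq> 0}) \<and> closure {x. \<phi> x \<noteq> 0} \<subseteq> \<Omega>}"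

definition has_weak_pd :: "pt set \<Rightarrow> 2 \<Rightarrow> scalar_fun \<Rightarrow> scalar_fun \<Rightarrow> bool" where
  "has_weak_pd \<Omega> i u g \<longleftrightarrow>
     u \<in> L2 \<Omega> \<and> g \<in> L2 \<Omega> \<and>
     (\<forall>\<phi>\<in>test_functions \<Omega>. L2_inner \<Omega> u (pd i \<phi>) = - L2_inner \<Omega> g \<phi>)"

text \<open>Weak derivatives are unique up to null sets; a representative is chosen.\<close>

definition weak_pd :: "pt set \<Rightarrow> 2 \<Rightarrow> scalar_fun \<Rightarrow> scalar_fun" where
  "weak_pd \<Omega> i u = (SOME g. has_weak_pd \<Omega> i u g)"

primrec sobolev :: "pt set \<Rightarrow> nat \<Rightarrow> scalar_fun set" where
  "sobolev \<Omega> 0 = L2 \<Omega>"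
| "sobolev \<Omega> (Suc m) = {u \<in> L2 \<Omega>. \<forall>i. \<exists>g\<in>sobolev \<Omega> m. has_weak_pd \<Omega> i u g}"

primrec sobolev_norm_sq :: "pt set \<Rightarrow> nat \<Rightarrow> scalar_fun \<Rightarrow> real" where
  "sobolev_norm_sq \<Omega> 0 u = L2_inner \<Omega> u u"
| "sobolev_norm_sq \<Omega> (Suc m) u =
     L2_inner \<Omega> u u + (\<Sum>i\<in>UNIV. sobolev_norm_sq \<Omega> m (weak_pd \<Omega> i u))"

text \<open>\<open>H\<^sup>m\<^sub>0(\<Omega>)\<close> is the closure of the test functions in \<open>H\<^sup>m(\<Omega>)\<close>. For \<open>m = 2\<close> the norm above
  counts first-order derivatives twice, which yields the same closure as the usual norm.\<close>

definition sobolev_0 :: "pt set \<Rightarrow> nat \<Rightarrow> scalar_fun set" where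
  "sobolev_0 \<Omega> m =
     {u \<in> sobolev \<Omega> m.
        \<forall>\<epsilon>>0. \<exists>\<phi>\<in>test_functions \<Omega>. sqrt (sobolev_norm_sq \<Omega> m (\<lambda>x. u x - \<phi> x)) < \<epsilon>}"

definition H1_norm :: "pt set \<Rightarrow> vector_fun \<Rightarrow> real" where
  "H1_norm \<Omega> v = sqrt (\<Sum>i\<in>UNIV. sobolev_norm_sq \<Omega> 1 (\<lambda>x. v x $ i))"

definition a_form :: "pt set \<Rightarrow> vector_fun \<Rightarrow> vector_fun \<Rightarrow> real" where
  "a_form \<Omega> u v = (\<Sum>i\<in>UNIV. \<Sum>j\<in>UNIV.
     L2_inner \<Omega> (weak_pd \<Omega> j (\<lambda>x. u x $ i)) (weak_pd \<Omega> j (\<lambda>x. v x $ i)))"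

definition H1_seminorm :: "pt set \<Rightarrow> vector_fun \<Rightarrow> real" where
  "H1_seminorm \<Omega> v = sqrt (\<Sum>i\<in>UNIV. \<Sum>j\<in>UNIV. (L2_norm \<Omega> (weak_pd \<Omega> j (\<lambda>x. v x $ i)))\<^sup>2)"

definition divergence :: "pt set \<Rightarrow> vector_fun \<Rightarrow> scalar_fun" where
  "divergence \<Omega> v = (\<lambda>x. \<Sum>i\<in>UNIV. weak_pd \<Omega> i (\<lambda>y. v y $ i) x)"

definition curl :: "pt set \<Rightarrow> scalar_fun \<Rightarrow> vector_fun" where
  "curl \<Omega> \<phi> = (\<lambda>x. vector [weak_pd \<Omega> 2 \<phi> x, - weak_pd \<Omega> 1 \<phi> x])"

definition b_form :: "pt set \<Rightarrow> vector_fun \<Rightarrow> scalar_fun \<Rightarrow> real" where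
  "b_form \<Omega> v p = - L2_inner \<Omega> (divergence \<Omega> v) p"

section \<open>Piecewise polynomials\<close>

definition polys :: "nat \<Rightarrow> scalar_fun set" where
  "polys m = {p. \<exists>c. p = (\<lambda>x. \<Sum>(i, j)\<in>{(i, j). i + j \<le> m}. c i j * (x $ 1) ^ i * (x $ 2) ^ j)}"

definition piecewise_poly :: "nat \<Rightarrow> pt set set \<Rightarrow> scalar_fun set" where
  "piecewise_poly m \<T> = {v. \<forall>K\<in>\<T>. \<exists>p\<in>polys m. ae_eq K v p}"

text \<open>The restriction \<open>v|\<^sub>K\<close>, as the unique polynomial that agrees with \<open>v\<close> almost everywhere in
  \<open>K\<close>. Its values and derivatives at boundary points of \<open>K\<close> are the one-sided ones.\<close>

definition piece :: "scalar_fun \<Rightarrow> pt set \<Rightarrow> scalar_fun" where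
  "piece v K = (THE p. p \<in> (\<Union>m. polys m) \<and> ae_eq K v p)"

definition C_at :: "nat \<Rightarrow> pt set set \<Rightarrow> scalar_fun \<Rightarrow> pt \<Rightarrow> bool" where
  "C_at r \<T> v a \<longleftrightarrow>
     (\<forall>K\<in>\<T>. \<forall>L\<in>\<T>. a \<in> verts K \<and> a \<in> verts L \<longrightarrow>
        (\<forall>i j. i + j \<le> r \<longrightarrow>
           (pd 1 ^^ i) ((pd 2 ^^ j) (piece v K)) a = (pd 1 ^^ i) ((pd 2 ^^ j) (piece v L)) a))"

section \<open>The finite element spaces\<close>

definition V_space :: "pt list \<Rightarrow> pt set \<Rightarrow> pt set set \<Rightarrow> nat \<Rightarrow> scalar_fun set" where
  "V_space cs \<Omega> \<T> k =
     {v \<in> sobolev \<Omega> 1. v \<in> piecewise_poly k \<T> \<and> (\<forall>a\<in>noncorner_vertices cs \<T>. C_at 1 \<T> v a)}"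

definition Q_space :: "pt list \<Rightarrow> pt set \<Rightarrow> pt set set \<Rightarrow> nat \<Rightarrow> scalar_fun set" where
  "Q_space cs \<Omega> \<T> k =
     {q \<in> L2 \<Omega>. q \<in> piecewise_poly (k - 1) \<T> \<and> (\<forall>a\<in>noncorner_vertices cs \<T>. C_at 0 \<T> q a)}"

definition V0 :: "pt list \<Rightarrow> pt set \<Rightarrow> pt set set \<Rightarrow> nat \<Rightarrow> scalar_fun set" where
  "V0 cs \<Omega> \<T> k = V_space cs \<Omega> \<T> k \<inter> sobolev_0 \<Omega> 1"

definition V0_vec :: "pt list \<Rightarrow> pt set \<Rightarrow> pt set set \<Rightarrow> nat \<Rightarrow> vector_fun set" where
  "V0_vec cs \<Omega> \<T> k = {v. \<forall>i. (\<lambda>x. v x $ i) \<in> V0 cs \<Omega> \<T> k}"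

definition Q0 :: "pt list \<Rightarrow> pt set \<Rightarrow> pt set set \<Rightarrow> nat \<Rightarrow> scalar_fun set" where
  "Q0 cs \<Omega> \<T> k = Q_space cs \<Omega> \<T> k \<inter> L2_0 \<Omega>"

definition Sigma0 :: "pt list \<Rightarrow> pt set \<Rightarrow> pt set set \<Rightarrow> nat \<Rightarrow> scalar_fun set" where
  "Sigma0 cs \<Omega> \<T> k =
     {\<phi> \<in> sobolev_0 \<Omega> 2. \<phi> \<in> piecewise_poly (k + 1) \<T> \<and>
        (\<forall>a\<in>noncorner_vertices cs \<T>. C_at 2 \<T> \<phi> a)}"

text \<open>On an edge \<open>e\<close>, the vanishing of the normal derivative does not depend on which of the two
  unit normals \<open>n\<close> is used.\<close>

definition Sigma_I :: "pt list \<Rightarrow> pt set \<Rightarrow> pt set set \<Rightarrow> nat \<Rightarrow> scalar_fun set" where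
  "Sigma_I cs \<Omega> \<T> k =
     {\<phi> \<in> Sigma0 cs \<Omega> \<T> k. \<forall>K\<in>\<T>.
        (\<forall>x\<in>frontier K. piece \<phi> K x = 0) \<and>
        (\<forall>e n. e edge_of K \<and> norm n = 1 \<and> (\<forall>y\<in>e. \<forall>z\<in>e. n \<bullet> (y - z) = 0) \<longrightarrow>
           (\<forall>x\<in>e. frechet_derivative (piece \<phi> K) (at x) n = 0))}"

definition Q_I :: "pt list \<Rightarrow> pt set \<Rightarrow> pt set set \<Rightarrow> nat \<Rightarrow> scalar_fun set" where
  "Q_I cs \<Omega> \<T> k =
     {q \<in> Q0 cs \<Omega> \<T> k. \<forall>K\<in>\<T>.
        (LINT x|lebesgue_on K. q x) = 0 \<and> (\<forall>a\<in>verts K. piece q K a = 0)}"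

definition Q_E :: "pt list \<Rightarrow> pt set \<Rightarrow> pt set set \<Rightarrow> nat \<Rightarrow> scalar_fun set" where
  "Q_E cs \<Omega> \<T> k = {q \<in> Q0 cs \<Omega> \<T> k. \<forall>r\<in>Q_I cs \<Omega> \<T> k. L2_inner \<Omega> q r = 0}"

definition V_E :: "pt list \<Rightarrow> pt set \<Rightarrow> pt set set \<Rightarrow> nat \<Rightarrow> vector_fun set" where
  "V_E cs \<Omega> \<T> k =
     {v \<in> V0_vec cs \<Omega> \<T> k.
        divergence \<Omega> v \<in> Q_E cs \<Omega> \<T> k \<and>
        (\<forall>\<psi>\<in>Sigma_I cs \<Omega> \<T> k. a_form \<Omega> v (curl \<Omega> \<psi>) = 0)}"

text \<open>The inf-sup property of \<open>V0 \<times> V0\<close> and \<open>Q0\<close>, in the form in which the constant \<open>\<beta>\<close> is provided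
  by the known stability result for corner-split meshes.\<close>

definition infsup_const :: "pt list \<Rightarrow> pt set \<Rightarrow> pt set set \<Rightarrow> nat \<Rightarrow> real \<Rightarrow> bool" where
  "infsup_const cs \<Omega> \<T> k \<beta> \<longleftrightarrow>
     (\<forall>q\<in>Q0 cs \<Omega> \<T> k. \<exists>v\<in>V0_vec cs \<Omega> \<T> k.
        ae_eq \<Omega> (divergence \<Omega> v) q \<and> H1_norm \<Omega> v \<le> inverse \<beta> * L2_norm \<Omega> q)"

end

theory Submission
  imports Defs
begin

text \<open>Let \<open>w\<close> be the lift of \<open>q\<close> that the inf-sup property of the full pair provides, and let \<open>p\<close> be the
  projection of \<open>w\<close>, with respect to the Dirichlet form \<open>a\<close>, onto the discrete velocities with zero
  divergence. Then \<open>v = w - p\<close> has the same divergence as \<open>w\<close>, is \<open>a\<close>-orthogonal to every discrete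
  solenoidal field, and satisfies \<open>a(v, v) = a(w, w) - a(p, p)\<close>, so its seminorm is at most the
  \<open>H\<^sup>1\<close> norm of \<open>w\<close> (\<open>divergence_lift_V_E\<close>). The orthogonality required in \<open>V_E\<close> follows because the
  curls of \<open>Sigma_I\<close> are solenoidal discrete velocities. The inf-sup bound follows by testing \<open>q\<close> with
  the lift of \<open>- q\<close> (\<open>inf_sup_lower_bound\<close>).

  Two points need work. The first is that the projection exists although functions are not identified
  when they agree almost everywhere. This holds because finitely many linear functionals, the values of the
  polynomial pieces at grid points, detect discrete velocities up to null sets (\<open>projection_exists\<close>,
  \<open>solenoidal_projection\<close>).

  The second is that the curl of a function in \<open>Sigma0\<close> is a solenoidal element of \<open>V0_vec\<close>
  (\<open>curl_Sigma0_V0_vec\<close>, \<open>divergence_curl\<close>). The weak derivative is an arbitrary choice among those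
  admitted by the definition, so everything rests on its uniqueness, hence on the fundamental lemma
  of the calculus of variations (\<open>fundamental_lemma\<close>), for which smooth bump functions on boxes are
  constructed. With integration by parts, uniqueness identifies the weak derivative of a piecewise
  polynomial on each triangle with the classical derivative of its polynomial piece
  (\<open>weak_pd_piece\<close>); this gives the polynomial degree, the continuity of derivatives at the vertices and the
  equality of mixed derivatives.\<close>

section \<open>Bivariate polynomials\<close>

lemma pd_eqI:
  assumes "(f has_derivative f') (at x)"
  shows "pd i f x = f' (axis i 1)"
  using frechet_derivative_at[OF assms] by (simp add: pd_def)

lemma pd_lincomb:
  assumes "f differentiable at x" "g differentiable at x"
  shows "pd i (\<lambda>x. f x + c * g x) x = pd i f x + c * pd i g x"
proof -
  have "((\<lambda>x. f x + c * g x) has_derivative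
      (\<lambda>h. frechet_derivative f (at x) h + c * frechet_derivative g (at x) h)) (at x)"
    using assms[unfolded frechet_derivative_works]
    by (intro has_derivative_add has_derivative_mult_right)
  from pd_eqI[OF this] show ?thesis by (simp add: pd_def)
qed

lemma finite_exponents: "finite {(i, j). i + j \<le> (m::nat)}"
  by (rule finite_subset[of _ "{..m} \<times> {..m}"]) auto

lemma polys_lincomb:
  assumes "p \<in> polys m" "q \<in> polys m"
  shows "(\<lambda>x. p x + c * q x) \<in> polys m"
proof -
  obtain d e where p: "p = (\<lambda>x. \<Sum>(i, j)\<in>{(i, j). i + j \<le> m}. d i j * (x $ 1) ^ i * (x $ 2) ^ j)"
    and q: "q = (\<lambda>x. \<Sum>(i, j)\<in>{(i, j). i + j \<le> m}. e i j * (x $ 1) ^ i * (x $ 2) ^ j)"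
    using assms unfolding polys_def by blast
  show ?thesis
    unfolding polys_def mem_Collect_eq
    by (rule exI[of _ "\<lambda>i j. d i j + c * e i j"])
      (simp add: p q sum_distrib_left sum.distrib [symmetric] case_prod_unfold algebra_simps)
qed

lemma polys_monomial:
  assumes "i + j \<le> m"
  shows "(\<lambda>x. c * (x $ 1) ^ i * (x $ 2) ^ j) \<in> polys m"
  unfolding polys_def mem_Collect_eq
proof (rule exI[of _ "\<lambda>i' j'. if i' = i \<and> j' = j then c else 0"], rule ext)
  fix x :: pt
  have "(\<Sum>(i', j')\<in>{(i, j). i + j \<le> m}.
      (if i' = i \<and> j' = j then c else 0) * (x $ 1) ^ i' * (x $ 2) ^ j')
      = (\<Sum>ij\<in>{(i, j). i + j \<le> m}. if ij = (i, j) then c * (x $ 1) ^ i * (x $ 2) ^ j else 0)"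
    by (rule sum.cong) (auto split: if_splits)
  also have "\<dots> = c * (x $ 1) ^ i * (x $ 2) ^ j"
    using assms finite_exponents[of m] by (simp add: sum.delta)
  finally show "c * (x $ 1) ^ i * (x $ 2) ^ j = (\<Sum>(i', j')\<in>{(i, j). i + j \<le> m}.
      (if i' = i \<and> j' = j then c else 0) * (x $ 1) ^ i' * (x $ 2) ^ j')" by simp
qed

lemma polys_zero: "(\<lambda>x. 0) \<in> polys m"
  using polys_monomial[of 0 0 m 0] by simp

lemma polys_induct [consumes 1, case_names zero step]:
  assumes "p \<in> polys m" and zero: "P (\<lambda>x. 0)"
    and step: "\<And>i j c p. \<lbrakk>i + j \<le> m; p \<in> polys m; P p\<rbrakk>
                 \<Longrightarrow> P (\<lambda>x. p x + c * ((x $ 1) ^ i * (x $ 2) ^ j))"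
  shows "P p"
proof -
  obtain d where p: "p = (\<lambda>x. \<Sum>(i, j)\<in>{(i, j). i + j \<le> m}. d i j * (x $ 1) ^ i * (x $ 2) ^ j)"
    using assms(1) unfolding polys_def by blast
  have "(\<lambda>x. \<Sum>(i, j)\<in>I. d i j * (x $ 1) ^ i * (x $ 2) ^ j) \<in> polys m \<and>
      P (\<lambda>x. \<Sum>(i, j)\<in>I. d i j * (x $ 1) ^ i * (x $ 2) ^ j)"
    if "finite I" "I \<subseteq> {(i, j). i + j \<le> m}" for I
    using that
  proof (induction I rule: finite_induct)
    case empty
    then show ?case using zero polys_zero by simp
  next
    case (insert ij I)
    obtain i j where ij: "ij = (i, j)" by force
    let ?q = "\<lambda>x::pt. \<Sum>(i, j)\<in>I. d i j * (x $ 1) ^ i * (x $ 2) ^ j"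
    have eq: "(\<lambda>x. \<Sum>(i, j)\<in>insert ij I. d i j * (x $ 1) ^ i * (x $ 2) ^ j)
        = (\<lambda>x. ?q x + d i j * ((x $ 1) ^ i * (x $ 2) ^ j))"
      using insert.hyps by (auto simp: ij fun_eq_iff)
    have deg: "i + j \<le> m" and q: "?q \<in> polys m" "P ?q"
      using insert ij by auto
    have "(\<lambda>x::pt. (x $ 1) ^ i * (x $ 2) ^ j) \<in> polys m"
      using polys_monomial[OF deg, of 1] by simp
    from polys_lincomb[OF q(1) this] step[OF deg q] show ?case
      unfolding eq by blast
  qed
  from this[OF finite_exponents subset_refl] show ?thesis unfolding p by blast
qed

lemma polys_mono:
  assumes "m \<le> n" "p \<in> polys m"
  shows "p \<in> polys n"
  using assms(2)
proof (induction rule: polys_induct)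
  case zero
  show ?case by (rule polys_zero)
next
  case (step i j c p)
  have "(\<lambda>x::pt. (x $ 1) ^ i * (x $ 2) ^ j) \<in> polys n"
    using polys_monomial[of i j n 1] step.hyps assms(1) by simp
  from polys_lincomb[OF step.IH this] show ?case .
qed

lemma has_derivative_monomial:
  "((\<lambda>x::pt. (x $ 1) ^ i * (x $ 2) ^ j) has_derivative
     (\<lambda>h. (real i * (x $ 1) ^ (i - 1) * (h $ 1)) * (x $ 2) ^ j
        + (x $ 1) ^ i * (real j * (x $ 2) ^ (j - 1) * (h $ 2)))) (at x)"
proof -
  have nth: "((\<lambda>x::pt. x $ k) has_derivative (\<lambda>h. h $ k)) (at x)" for k
    by (rule bounded_linear.has_derivative[OF bounded_linear_vec_nth has_derivative_ident])
  show ?thesis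
    by (rule has_derivative_eq_rhs, rule has_derivative_mult,
        (rule has_derivative_power[OF nth])+) (auto simp: fun_eq_iff algebra_simps)
qed

lemma monomial_differentiable: "(\<lambda>x::pt. (x $ 1) ^ i * (x $ 2) ^ j) differentiable at x"
  using has_derivative_monomial unfolding differentiable_def by blast

lemma pd_monomial:
  "pd 1 (\<lambda>x. (x $ 1) ^ i * (x $ 2) ^ j) = (\<lambda>x. real i * ((x $ 1) ^ (i - 1) * (x $ 2) ^ j))"
  "pd 2 (\<lambda>x. (x $ 1) ^ i * (x $ 2) ^ j) = (\<lambda>x. real j * ((x $ 1) ^ i * (x $ 2) ^ (j - 1)))"
  by (auto simp: fun_eq_iff pd_eqI[OF has_derivative_monomial] axis_def)

lemma polys_differentiable: "p \<in> polys m \<Longrightarrow> p differentiable at x"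
proof (induction rule: polys_induct)
  case (step i j c p)
  show ?case
    by (intro differentiable_add differentiable_mult differentiable_const step.IH
        monomial_differentiable)
qed simp

lemma polys_continuous_on: "p \<in> polys m \<Longrightarrow> continuous_on S p"
  by (meson continuous_at_imp_continuous_on differentiable_imp_continuous_within
      polys_differentiable)

lemma pd_polys_step:
  assumes "p \<in> polys m"
  shows "pd k (\<lambda>x. p x + c * ((x $ 1) ^ i * (x $ 2) ^ j))
       = (\<lambda>x. pd k p x + c * pd k (\<lambda>x. (x $ 1) ^ i * (x $ 2) ^ j) x)"
  using polys_differentiable[OF assms] monomial_differentiable by (intro ext pd_lincomb)

lemma pd_zero: "pd k (\<lambda>x. 0) = (\<lambda>x. 0)"
  by (simp add: pd_def)

lemma polys_pd: "p \<in> polys (Suc m) \<Longrightarrow> pd k p \<in> polys m"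
proof (induction rule: polys_induct)
  case zero
  show ?case by (simp add: pd_zero polys_zero)
next
  case (step i j c p)
  have "pd k (\<lambda>x. (x $ 1) ^ i * (x $ 2) ^ j) \<in> polys m"
  proof (cases "k = 1")
    case True
    show ?thesis
      using polys_monomial[of "i - 1" j m "real i"] step.hyps(1) polys_zero
      unfolding True pd_monomial by (cases i) (auto simp: mult.assoc)
  next
    case False
    then have k: "k = 2" by (metis exhaust_2)
    show ?thesis
      using polys_monomial[of i "j - 1" m "real j"] step.hyps(1) polys_zero
      unfolding k pd_monomial by (cases j) (auto simp: mult.assoc)
  qed
  then show ?case
    unfolding pd_polys_step[OF step.hyps(2)] by (intro polys_lincomb step.IH)
qed

lemma pd_polys_commute: "p \<in> polys m \<Longrightarrow> pd 1 (pd 2 p) = pd 2 (pd 1 p)"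
proof (induction rule: polys_induct)
  case zero
  show ?case by (simp add: pd_zero)
next
  case (step i j c p)
  have p: "pd k p \<in> polys m" for k
    using polys_pd polys_mono[of m "Suc m"] step.hyps(2) by simp
  have aux: "pd k (\<lambda>x. pd l p x + c * (d * ((x $ 1) ^ i * (x $ 2) ^ j)))
     = (\<lambda>x. pd k (pd l p) x + c * d * pd k (\<lambda>x. (x $ 1) ^ i * (x $ 2) ^ j) x)" for k l i j d
    using pd_polys_step[OF p, of k l "c * d" i j] by (simp add: mult.assoc)
  show ?case
    unfolding pd_polys_step[OF step.hyps(2)] pd_monomial aux
    by (simp add: step.IH algebra_simps)
qed

lemma polys_real_polynomial_function: "p \<in> polys m \<Longrightarrow> real_polynomial_function p"
proof (induction rule: polys_induct)
  case (step i j c p)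
  have "real_polynomial_function (\<lambda>x::pt. x $ k)" for k
    by (rule real_polynomial_function.intros(1)) (rule bounded_linear_vec_nth)
  then show ?case
    by (intro real_polynomial_function.intros(2-) real_polynomial_function_power step.IH)
qed (rule real_polynomial_function.intros(2))

text \<open>Restricted to a line through a point of the open set, the polynomial becomes a univariate one
  with infinitely many roots.\<close>

lemma polys_zero_on_open:
  assumes p: "p \<in> polys m" and U: "open U" "a \<in> U" "\<And>x. x \<in> U \<Longrightarrow> p x = 0"
  shows "p = (\<lambda>x. 0)"
proof
  fix y
  define g where "g = (\<lambda>t::real. p (a + t *\<^sub>R (y - a)))"
  have "polynomial_function (\<lambda>t::real. a + t *\<^sub>R (y - a))"
    by (intro polynomial_function_add polynomial_function_mult) auto
  with polys_real_polynomial_function[OF p] have "real_polynomial_function g"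
    unfolding g_def
    using real_polynomial_function_compose[of "\<lambda>t::real. a + t *\<^sub>R (y - a)" p] by (simp add: o_def)
  then obtain c n where g: "g = (\<lambda>t. \<Sum>i\<le>n. c i * t ^ i)"
    using real_polynomial_function_imp_sum by blast
  have "open ((\<lambda>t. a + t *\<^sub>R (y - a)) -` U)"
    by (rule open_vimage[OF U(1)]) (intro continuous_intros)
  moreover have "0 \<in> (\<lambda>t. a + t *\<^sub>R (y - a)) -` U" using U(2) by simp
  ultimately have "infinite ((\<lambda>t. a + t *\<^sub>R (y - a)) -` U)"
    by (metis empty_iff finite_imp_not_open)
  moreover have "(\<Sum>i\<le>n. c i * t ^ i) = 0" if "a + t *\<^sub>R (y - a) \<in> U" for t
    using U(3)[OF that] fun_cong[OF g, of t] by (simp add: g_def)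
  then have "(\<lambda>t. a + t *\<^sub>R (y - a)) -` U \<subseteq> {t. (\<Sum>i\<le>n. c i * t ^ i) = 0}"
    by blast
  ultimately have "infinite {t. (\<Sum>i\<le>n. c i * t ^ i) = 0}"
    using finite_subset by blast
  then have "\<forall>i\<le>n. c i = 0" using polyfun_finite_roots[of c n] by blast
  then have "g 1 = 0" by (simp add: g)
  then show "p y = 0" by (simp add: g_def)
qed

text \<open>A polynomial of total degree at most \<open>m\<close> has degree at most \<open>m\<close> in each variable, so the grid
  determines it one variable at a time. Its point evaluations are the finitely many linear
  functionals that witness the finite dimension of the discrete spaces.\<close>

lemma polys_zero_on_grid:
  assumes p: "p \<in> polys m"
    and zero: "\<And>a b. \<lbrakk>a \<le> m; b \<le> m\<rbrakk> \<Longrightarrow> p (vector [real a, real b]) = 0"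
  shows "p = (\<lambda>x. 0)"
proof -
  obtain d where d: "p = (\<lambda>x. \<Sum>(i, j)\<in>{(i, j). i + j \<le> m}. d i j * (x $ 1) ^ i * (x $ 2) ^ j)"
    using assms(1) unfolding polys_def by blast
  define e where "e i j = (if i + j \<le> m then d i j else 0)" for i j
  have p_eq: "p x = (\<Sum>i\<le>m. (\<Sum>j\<le>m. e i j * (x $ 2) ^ j) * (x $ 1) ^ i)" for x
  proof -
    have "p x = (\<Sum>(i, j)\<in>{..m} \<times> {..m}. e i j * (x $ 1) ^ i * (x $ 2) ^ j)"
      unfolding d by (rule sum.mono_neutral_cong_left) (auto simp: e_def split: if_splits)
    then show ?thesis
      by (simp add: sum.cartesian_product [symmetric] sum_distrib_left
          sum_distrib_right ac_simps)
  qed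
  have roots: "c i = 0"
    if "\<And>a. a \<le> m \<Longrightarrow> (\<Sum>i\<le>m. c i * real a ^ i) = 0" "i \<le> m" for c :: "nat \<Rightarrow> real" and i
  proof (rule ccontr)
    assume "c i \<noteq> 0"
    then have "card {t. (\<Sum>i\<le>m. c i * t ^ i) = 0} \<le> m" "finite {t. (\<Sum>i\<le>m. c i * t ^ i) = 0}"
      using Transcendental.polyfun_rootbound[of c i m] that(2) by auto
    moreover have "real ` {..m} \<subseteq> {t. (\<Sum>i\<le>m. c i * t ^ i) = 0}"
      using that(1) by auto
    ultimately have "card (real ` {..m}) \<le> m" by (meson card_mono le_trans)
    then show False by (simp add: card_image)
  qed
  have "e i j = 0" if "i \<le> m" "j \<le> m" for i j
  proof (rule roots[OF _ that(2)])
    fix b assume b: "b \<le> m"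
    show "(\<Sum>j\<le>m. e i j * real b ^ j) = 0"
    proof (rule roots[of "\<lambda>i. \<Sum>j\<le>m. e i j * real b ^ j", OF _ that(1)])
      fix a assume "a \<le> m"
      from zero[OF this b] show "(\<Sum>i\<le>m. (\<Sum>j\<le>m. e i j * real b ^ j) * real a ^ i) = 0"
        by (simp add: p_eq)
    qed
  qed
  then show ?thesis by (simp add: p_eq fun_eq_iff)
qed

section \<open>Smooth bump functions on boxes\<close>

lemma AE_lebesgue_on_iff_negligible:
  assumes "S \<in> sets lebesgue"
  shows "(AE x in lebesgue_on S. P x) \<longleftrightarrow> negligible {x \<in> S. \<not> P x}"
proof -
  have "(AE x in lebesgue_on S. P x) \<longleftrightarrow> (AE x in lebesgue. x \<in> S \<longrightarrow> P x)"
    using assms by (intro AE_restrict_space_iff) simp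
  also have "\<dots> \<longleftrightarrow> negligible {x \<in> S. \<not> P x}"
    unfolding completion.AE_iff_null_sets negligible_iff_null_sets by simp
  finally show ?thesis .
qed

text \<open>The factor \<open>inverse t ^ n\<close> makes the derivative of each such function a combination of functions
  of the same family, so that smoothness follows by closure. The parameter \<open>c\<close> is kept because the
  functions with \<open>n = 0\<close> increase to the indicator of the positive half-line as \<open>c\<close> tends to \<open>0\<close>.\<close>

definition flat_exp :: "real \<Rightarrow> nat \<Rightarrow> real \<Rightarrow> real" where
  "flat_exp c n t = (if t > 0 then inverse t ^ n * exp (- c * inverse t) else 0)"

lemma has_derivative_flat_exp:
  assumes "c > 0"
  shows "(flat_exp c n has_real_derivative
     c * flat_exp c (n + 2) t - real n * flat_exp c (n + 1) t) (at t)"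
proof -
  consider "t > 0" | "t < 0" | "t = 0" by linarith
  then show ?thesis
  proof cases
    case 1
    have "((\<lambda>t. inverse t ^ n * exp (- c * inverse t)) has_real_derivative
       c * flat_exp c (n + 2) t - real n * flat_exp c (n + 1) t) (at t)"
      using 1 by (auto intro!: derivative_eq_intros)
        (cases n; simp add: flat_exp_def field_simps power2_eq_square)
    then show ?thesis
      by (rule DERIV_cong_ev[OF refl _ refl, THEN iffD1, rotated])
        (use 1 in \<open>auto simp: flat_exp_def eventually_nhds intro!: exI[of _ "{0<..}"]\<close>)
  next
    case 2
    have "((\<lambda>t. 0) has_real_derivative 0) (at t)" by simp
    then have "(flat_exp c n has_real_derivative 0) (at t)"
      by (rule DERIV_cong_ev[OF refl _ refl, THEN iffD1, rotated])
        (use 2 in \<open>auto simp: flat_exp_def eventually_nhds intro!: exI[of _ "{..<0}"]\<close>)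
    then show ?thesis using 2 by (simp add: flat_exp_def)
  next
    case 3
    have "((\<lambda>h. flat_exp c n h / h) \<longlongrightarrow> 0) (at 0)"
    proof (rule filterlim_split_at)
      show "((\<lambda>h. flat_exp c n h / h) \<longlongrightarrow> 0) (at_left 0)"
        by (rule tendsto_eventually) (auto simp: flat_exp_def eventually_at_filter)
      \<comment> \<open>With \<open>s = inverse h\<close> the difference quotient at \<open>0\<close> is a power of \<open>s\<close> times a decaying exponential.\<close>
      have "((\<lambda>s::real. s ^ (n + 1) * exp (- c * s)) \<longlongrightarrow> 0) at_top"
      proof -
        have "filterlim (\<lambda>s. c * s) at_top at_top"
          by (rule filterlim_tendsto_pos_mult_at_top[OF tendsto_const assms filterlim_ident])
        from filterlim_compose[OF tendsto_power_div_exp_0[of "n + 1"] this]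
        have "((\<lambda>s. inverse c ^ (n + 1) * ((c * s) ^ (n + 1) / exp (c * s))) \<longlongrightarrow> inverse c ^ (n + 1) * 0) at_top"
          by (rule tendsto_mult_left)
        then show ?thesis
          using assms by (simp add: power_mult_distrib exp_minus field_simps)
      qed
      then have "((\<lambda>h::real. inverse h ^ (n + 1) * exp (- c * inverse h)) \<longlongrightarrow> 0) (at_right 0)"
        by (rule filterlim_compose[OF _ filterlim_inverse_at_top_right])
      then show "((\<lambda>h. flat_exp c n h / h) \<longlongrightarrow> 0) (at_right 0)"
        by (rule Lim_transform_eventually)
          (auto simp: flat_exp_def eventually_at_filter field_simps)
    qed
    then show ?thesis
      unfolding 3 has_field_derivative_iff by (simp add: flat_exp_def)
  qed
qed

text \<open>Built to be closed under partial derivatives, which turns smoothness of the products below into an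
  induction instead of a computation of all higher derivatives.\<close>

inductive_set flat_algebra :: "real \<Rightarrow> scalar_fun set" for c :: real where
  base: "(\<lambda>x. flat_exp c n (s * x $ k + d)) \<in> flat_algebra c"
| const: "(\<lambda>x. r) \<in> flat_algebra c"
| add: "f \<in> flat_algebra c \<Longrightarrow> g \<in> flat_algebra c \<Longrightarrow> (\<lambda>x. f x + g x) \<in> flat_algebra c"
| mult: "f \<in> flat_algebra c \<Longrightarrow> g \<in> flat_algebra c \<Longrightarrow> (\<lambda>x. f x * g x) \<in> flat_algebra c"

lemma flat_algebra_pd:
  assumes "c > 0" "f \<in> flat_algebra c"
  shows "(\<forall>x. f differentiable at x) \<and> pd i f \<in> flat_algebra c"
  using assms(2)
proof (induction rule: flat_algebra.induct)
  case (base n s k d)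
  have der: "((\<lambda>x::pt. flat_exp c n (s * x $ k + d)) has_derivative
      (\<lambda>h. (s * h $ k) * (c * flat_exp c (n + 2) (s * x $ k + d)
            - real n * flat_exp c (n + 1) (s * x $ k + d)))) (at x)" for x
  proof -
    have "((\<lambda>x::pt. s * x $ k + d) has_derivative (\<lambda>h. s * h $ k)) (at x)"
      by (intro has_derivative_add_const has_derivative_mult_right
          bounded_linear.has_derivative[OF bounded_linear_vec_nth has_derivative_ident])
    from DERIV_compose_FDERIV[OF has_derivative_flat_exp[OF assms(1)] this]
    show ?thesis .
  qed
  have "pd i (\<lambda>x::pt. flat_exp c n (s * x $ k + d))
      = (\<lambda>x. (s * axis i 1 $ k * c) * flat_exp c (n + 2) (s * x $ k + d)
           + (- s * axis i 1 $ k * real n) * flat_exp c (n + 1) (s * x $ k + d))"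
    by (rule ext, rule trans[OF pd_eqI[OF der]]) (simp add: algebra_simps)
  then have "pd i (\<lambda>x::pt. flat_exp c n (s * x $ k + d)) \<in> flat_algebra c"
    by (simp only:) (intro flat_algebra.intros)
  moreover have "(\<lambda>x::pt. flat_exp c n (s * x $ k + d)) differentiable at x" for x
    using der unfolding differentiable_def by blast
  ultimately show ?case by blast
next
  case (const r)
  then show ?case using flat_algebra.const[of 0 c] by (simp add: pd_def)
next
  case (add f g)
  then have "pd i (\<lambda>x. f x + g x) = (\<lambda>x. pd i f x + pd i g x)"
    using pd_lincomb[of f _ g i 1] by auto
  with add show ?case by (auto intro: flat_algebra.add)
next
  case (mult f g)
  have "((\<lambda>x. f x * g x) has_derivative
      (\<lambda>h. f x * frechet_derivative g (at x) h + frechet_derivative f (at x) h * g x)) (at x)" for x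
    using mult.IH by (intro has_derivative_mult) (auto simp: frechet_derivative_works)
  from pd_eqI[OF this] have "pd i (\<lambda>x. f x * g x) = (\<lambda>x. f x * pd i g x + pd i f x * g x)"
    by (auto simp: pd_def)
  with mult show ?case by (auto intro: flat_algebra.intros)
qed

lemma smooth_flat_algebra:
  assumes "c > 0" "f \<in> flat_algebra c"
  shows "smooth f"
proof -
  have "foldr pd is f \<in> flat_algebra c" for "is"
    using assms flat_algebra_pd by (induction "is") auto
  then show ?thesis
    unfolding smooth_def differentiable_on_def
    using flat_algebra_pd[OF assms(1)] by (meson UNIV_I differentiable_at_withinI)
qed

definition bump :: "pt \<Rightarrow> pt \<Rightarrow> real \<Rightarrow> scalar_fun" where
  "bump a b c x = flat_exp c 0 (x $ 1 - a $ 1) * flat_exp c 0 (b $ 1 - x $ 1) *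
                 (flat_exp c 0 (x $ 2 - a $ 2) * flat_exp c 0 (b $ 2 - x $ 2))"

lemma mem_box_2: "(x::pt) \<in> box a b \<longleftrightarrow>
    a $ 1 < x $ 1 \<and> x $ 1 < b $ 1 \<and> a $ 2 < x $ 2 \<and> x $ 2 < b $ 2"
  by (auto simp: mem_box_cart forall_2)

lemma bump_eq_0_iff: "bump a b c x = 0 \<longleftrightarrow> x \<notin> box a b"
  by (auto simp: bump_def flat_exp_def mem_box_2)

lemma bump_bounds: "c > 0 \<Longrightarrow> 0 \<le> bump a b c x \<and> bump a b c x \<le> 1"
  unfolding bump_def by (auto intro!: mult_le_one simp: flat_exp_def)

text \<open>Together with \<open>bump_bounds\<close> this is bounded pointwise convergence, so the limit may be taken under
  the integral against an integrable function.\<close>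

lemma bump_tendsto_indicator:
  "(\<lambda>n. bump a b (inverse (real (Suc n))) x) \<longlonglongrightarrow> indicator (box a b) x"
proof -
  have *: "(\<lambda>n. flat_exp (inverse (real (Suc n))) 0 t) \<longlonglongrightarrow> (if t > 0 then 1 else 0)" for t
  proof -
    have "(\<lambda>n. exp (- inverse (real (Suc n)) * inverse t)) \<longlonglongrightarrow> exp (- 0 * inverse t)"
      by (intro tendsto_intros LIMSEQ_inverse_real_of_nat)
    then show ?thesis by (simp add: flat_exp_def)
  qed
  have "(\<lambda>n. bump a b (inverse (real (Suc n))) x) \<longlonglongrightarrow>
    (if x $ 1 - a $ 1 > 0 then 1 else 0) * (if b $ 1 - x $ 1 > 0 then 1 else 0) *
    ((if x $ 2 - a $ 2 > 0 then 1 else 0) * (if b $ 2 - x $ 2 > 0 then 1 else 0))"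
    unfolding bump_def by (intro tendsto_mult *)
  moreover have "(if x $ 1 - a $ 1 > 0 then 1 else 0) * (if b $ 1 - x $ 1 > 0 then 1 else 0) *
    ((if x $ 2 - a $ 2 > 0 then 1 else 0) * (if b $ 2 - x $ 2 > 0 then 1 else 0))
    = (indicator (box a b) x :: real)"
    by (simp add: mem_box_2 indicator_def)
  ultimately show ?thesis by simp
qed

lemma bump_test_function:
  assumes "c > 0" "cbox a b \<subseteq> U"
  shows "bump a b c \<in> test_functions U"
proof -
  have "(\<lambda>x. flat_exp c 0 (1 * x $ 1 + - a $ 1) * flat_exp c 0 (- 1 * x $ 1 + b $ 1) *
      (flat_exp c 0 (1 * x $ 2 + - a $ 2) * flat_exp c 0 (- 1 * x $ 2 + b $ 2))) \<in> flat_algebra c"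
    by (intro flat_algebra.intros)
  then have "bump a b c \<in> flat_algebra c"
    by (simp add: bump_def[abs_def])
  moreover have "closure {x. bump a b c x \<noteq> 0} \<subseteq> cbox a b"
    by (intro closure_minimal) (use box_subset_cbox in \<open>auto simp: bump_eq_0_iff\<close>)
  moreover from this have "compact (closure {x. bump a b c x \<noteq> 0})"
    by (meson bounded_cbox bounded_subset closed_closure compact_eq_bounded_closed)
  ultimately show ?thesis
    using assms smooth_flat_algebra unfolding test_functions_def by blast
qed

section \<open>Square-integrable functions\<close>

lemma L2_mult_integrable:
  assumes "f \<in> L2 S" "g \<in> L2 S"
  shows "integrable (lebesgue_on S) (\<lambda>x. f x * g x)"
proof (rule Bochner_Integration.integrable_bound)
  show "integrable (lebesgue_on S) (\<lambda>x. (f x)\<^sup>2 + (g x)\<^sup>2)"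
    using assms by (auto simp: L2_def)
  show "AE x in lebesgue_on S. norm (f x * g x) \<le> norm ((f x)\<^sup>2 + (g x)\<^sup>2)"
  proof (rule AE_I2)
    fix x
    have "2 * \<bar>f x * g x\<bar> \<le> (f x)\<^sup>2 + (g x)\<^sup>2"
      using sum_squares_bound[of "\<bar>f x\<bar>" "\<bar>g x\<bar>"] by (simp add: abs_mult)
    then show "norm (f x * g x) \<le> norm ((f x)\<^sup>2 + (g x)\<^sup>2)" by simp
  qed
qed (use assms in \<open>auto simp: L2_def\<close>)

lemma L2_lincomb:
  assumes "f \<in> L2 S" "g \<in> L2 S"
  shows "(\<lambda>x. f x + c * g x) \<in> L2 S"
proof -
  have "(\<lambda>x. (f x + c * g x)\<^sup>2) = (\<lambda>x. (f x)\<^sup>2 + 2 * c * (f x * g x) + c\<^sup>2 * (g x)\<^sup>2)"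
    by (auto simp: power2_eq_square algebra_simps)
  then show ?thesis
    using assms L2_mult_integrable[OF assms] by (auto simp: L2_def)
qed

lemma L2_inner_lincomb_left:
  assumes "f \<in> L2 S" "g \<in> L2 S" "h \<in> L2 S"
  shows "L2_inner S (\<lambda>x. f x + c * g x) h = L2_inner S f h + c * L2_inner S g h"
  using L2_mult_integrable[OF assms(1,3)] L2_mult_integrable[OF assms(2,3)]
  unfolding L2_inner_def by (simp add: distrib_right mult.assoc)

lemma L2_inner_commute: "L2_inner S f g = L2_inner S g f"
  unfolding L2_inner_def by (simp add: mult.commute)

lemma L2_inner_self_nonneg: "0 \<le> L2_inner S f f"
  unfolding L2_inner_def by simp

lemma ae_eq_refl: "ae_eq S f f" and ae_eq_sym: "ae_eq S f g \<Longrightarrow> ae_eq S g f"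
  unfolding ae_eq_def by auto

lemma ae_eq_trans: "ae_eq S f g \<Longrightarrow> ae_eq S g h \<Longrightarrow> ae_eq S f h"
  unfolding ae_eq_def by auto

lemma ae_eq_measurable:
  assumes "S \<in> sets lebesgue" "f \<in> borel_measurable (lebesgue_on S)" "ae_eq S f g"
  shows "g \<in> borel_measurable (lebesgue_on S)"
proof -
  have "AE x in lebesgue. x \<in> S \<longrightarrow> f x = g x"
    using assms(1,3) unfolding ae_eq_def by (subst (asm) AE_restrict_space_iff) auto
  then have "AE x in lebesgue. (if x \<in> S then f x else 0) = (if x \<in> S then g x else 0)"
    by auto
  moreover have "(\<lambda>x. if x \<in> S then f x else 0) \<in> borel_measurable lebesgue"
    using assms(1,2) by (simp add: borel_measurable_if)
  ultimately have "(\<lambda>x. if x \<in> S then g x else 0) \<in> borel_measurable lebesgue"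
    by (rule borel_measurable_AE[rotated])
  then show ?thesis using assms(1) by (simp add: borel_measurable_if)
qed

lemma L2_ae_eq:
  assumes "S \<in> sets lebesgue" "f \<in> L2 S" "ae_eq S f g"
  shows "g \<in> L2 S"
proof -
  have g: "g \<in> borel_measurable (lebesgue_on S)"
    using assms(2) by (intro ae_eq_measurable[OF assms(1) _ assms(3)]) (simp add: L2_def)
  have "integrable (lebesgue_on S) (\<lambda>x. (f x)\<^sup>2) = integrable (lebesgue_on S) (\<lambda>x. (g x)\<^sup>2)"
    using assms g by (intro integrable_cong_AE) (auto simp: L2_def ae_eq_def)
  then show ?thesis using assms(2) g by (simp add: L2_def)
qed

lemma L2_inner_ae_eq:
  assumes "S \<in> sets lebesgue" "f \<in> L2 S" "g \<in> L2 S" "ae_eq S f f'" "ae_eq S g g'"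
  shows "L2_inner S f' g' = L2_inner S f g"
  unfolding L2_inner_def
proof (rule integral_cong_AE)
  have "f' \<in> L2 S" "g' \<in> L2 S" using L2_ae_eq assms by blast+
  then show "(\<lambda>x. f' x * g' x) \<in> borel_measurable (lebesgue_on S)" by (auto simp: L2_def)
  show "(\<lambda>x. f x * g x) \<in> borel_measurable (lebesgue_on S)" using assms by (auto simp: L2_def)
  show "AE x in lebesgue_on S. f' x * g' x = f x * g x"
    using assms(4,5) unfolding ae_eq_def by auto
qed

lemma L2_inner_self_eq_0:
  assumes "f \<in> L2 S" "L2_inner S f f = 0"
  shows "ae_eq S f (\<lambda>x. 0)"
proof -
  have "integrable (lebesgue_on S) (\<lambda>x. f x * f x)"
    using L2_mult_integrable assms by blast
  then have "AE x in lebesgue_on S. f x * f x = 0"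
    using integral_nonneg_eq_0_iff_AE[of "lebesgue_on S" "\<lambda>x. f x * f x"] assms(2)
    by (simp add: L2_inner_def)
  then show ?thesis unfolding ae_eq_def by auto
qed

section \<open>Test functions and integration by parts\<close>

lemma test_function_smooth:
  assumes "\<phi> \<in> test_functions U"
  shows "\<phi> differentiable at x" "continuous_on S \<phi>"
    "pd i \<phi> differentiable at x" "continuous_on S (pd i \<phi>)"
proof -
  have sm: "foldr pd is \<phi> differentiable at x" for "is" x
    using assms by (auto simp: test_functions_def smooth_def differentiable_on_def)
  show "\<phi> differentiable at x" for x using sm[of "[]"] by simp
  then show "continuous_on S \<phi>"
    by (meson continuous_at_imp_continuous_on differentiable_imp_continuous_within)
  show "pd i \<phi> differentiable at x" for x using sm[of "[i]"] by simp
  then show "continuous_on S (pd i \<phi>)"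
    by (meson continuous_at_imp_continuous_on differentiable_imp_continuous_within)
qed

lemma test_function_support:
  assumes "\<phi> \<in> test_functions U"
  obtains C where "compact C" "C \<subseteq> U" "\<And>x. x \<notin> C \<Longrightarrow> \<phi> x = 0"
proof
  show "compact (closure {x. \<phi> x \<noteq> 0})" "closure {x. \<phi> x \<noteq> 0} \<subseteq> U"
    using assms by (auto simp: test_functions_def)
  show "\<phi> x = 0" if "x \<notin> closure {x. \<phi> x \<noteq> 0}" for x
    using that closure_subset[of "{x. \<phi> x \<noteq> 0}"] by auto
qed

lemma pd_eq_0_outside:
  assumes "closed C" "\<And>x. x \<notin> C \<Longrightarrow> f x = 0" "x \<notin> C"
  shows "pd i f x = 0"
proof -
  have "((\<lambda>x. 0) has_derivative (\<lambda>h. 0)) (at x)" by simp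
  then have "(f has_derivative (\<lambda>h. 0)) (at x)"
    by (rule has_derivative_transform_within_open[of _ _ _ _ "- C"]) (use assms in auto)
  from pd_eqI[OF this] show ?thesis .
qed

lemma test_function_mono: "U \<subseteq> \<Omega> \<Longrightarrow> \<phi> \<in> test_functions U \<Longrightarrow> \<phi> \<in> test_functions \<Omega>"
  by (auto simp: test_functions_def)

lemma test_function_pd:
  assumes "\<phi> \<in> test_functions U"
  shows "pd i \<phi> \<in> test_functions U"
proof -
  obtain C where C: "compact C" "C \<subseteq> U" "\<And>x. x \<notin> C \<Longrightarrow> \<phi> x = 0"
    using test_function_support[OF assms] by blast
  have "smooth (pd i \<phi>)"
    unfolding smooth_def
  proof
    fix "is"
    have "foldr pd (is @ [i]) \<phi> differentiable_on UNIV"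
      using assms unfolding test_functions_def smooth_def by blast
    then show "foldr pd is (pd i \<phi>) differentiable_on UNIV" by simp
  qed
  moreover have sub: "closure {x. pd i \<phi> x \<noteq> 0} \<subseteq> C"
  proof (rule closure_minimal)
    show "{x. pd i \<phi> x \<noteq> 0} \<subseteq> C"
      using pd_eq_0_outside[where f = \<phi>, OF compact_imp_closed[OF C(1)] C(3)] by blast
  qed (rule compact_imp_closed[OF C(1)])
  moreover have "compact (closure {x. pd i \<phi> x \<noteq> 0})"
    using sub C(1) by (meson bounded_subset closed_closure compact_eq_bounded_closed)
  ultimately show ?thesis using C(2) unfolding test_functions_def by blast
qed

lemma test_function_lincomb:
  assumes "\<phi> \<in> test_functions U" "\<psi> \<in> test_functions U"
  shows "(\<lambda>x. \<phi> x + c * \<psi> x) \<in> test_functions U"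
proof -
  have diff: "foldr pd is f differentiable at x" if "f \<in> test_functions U" for f "is" x
    using that by (auto simp: test_functions_def smooth_def differentiable_on_def)
  have "foldr pd is (\<lambda>x. \<phi> x + c * \<psi> x) = (\<lambda>x. foldr pd is \<phi> x + c * foldr pd is \<psi> x)" for "is"
  proof (induction "is")
    case (Cons i "is")
    show ?case
      by (simp only: foldr_Cons o_apply Cons.IH)
        (intro ext pd_lincomb diff assms)
  qed simp
  then have "smooth (\<lambda>x. \<phi> x + c * \<psi> x)"
    using assms unfolding smooth_def test_functions_def
    by (auto intro!: differentiable_on_add differentiable_on_mult)
  moreover have sub: "closure {x. \<phi> x + c * \<psi> x \<noteq> 0}
      \<subseteq> closure {x. \<phi> x \<noteq> 0} \<union> closure {x. \<psi> x \<noteq> 0}" (is "_ \<subseteq> ?C")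
    unfolding closure_Un [symmetric] by (rule closure_mono) auto
  moreover have "compact (closure {x. \<phi> x + c * \<psi> x \<noteq> 0})"
  proof -
    have "compact ?C" using assms by (intro compact_Un) (auto simp: test_functions_def)
    then show ?thesis
      using sub by (meson bounded_subset closed_closure compact_eq_bounded_closed)
  qed
  ultimately show ?thesis using assms unfolding test_functions_def by blast
qed

lemma integrable_compact_support:
  fixes f :: scalar_fun
  assumes "continuous_on UNIV f" "compact C" "\<And>x. x \<notin> C \<Longrightarrow> f x = 0"
  shows "integrable lborel f"
proof -
  have "integrable lborel (\<lambda>x. indicator C x *\<^sub>R f x)"
    using assms by (intro borel_integrable_compact) (auto intro: continuous_on_subset)
  moreover have "(\<lambda>x. indicator C x *\<^sub>R f x) = f"
    using assms(3) by (auto simp: indicator_def fun_eq_iff)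
  ultimately show ?thesis by simp
qed

lemma line_has_derivative_pd:
  assumes "\<And>x. f differentiable at x"
  shows "((\<lambda>t. f (x + t *\<^sub>R axis i 1)) has_real_derivative pd i f (x + t *\<^sub>R axis i 1)) (at t)"
proof -
  let ?y = "x + t *\<^sub>R axis i (1::real)"
  let ?D = "frechet_derivative f (at ?y)"
  have D: "(f has_derivative ?D) (at ?y)"
    using assms frechet_derivative_works by blast
  have "((\<lambda>t. x + t *\<^sub>R axis i (1::real)) has_derivative (\<lambda>h. h *\<^sub>R axis i 1)) (at t)"
    by (auto intro!: derivative_eq_intros)
  from has_derivative_compose[OF this D]
  have "((\<lambda>t. f (x + t *\<^sub>R axis i 1)) has_derivative (\<lambda>h. ?D (h *\<^sub>R axis i 1))) (at t)" .
  moreover have "(\<lambda>h. ?D (h *\<^sub>R axis i 1)) = (\<lambda>h. pd i f ?y * h)"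
    using has_derivative_linear[OF D] by (auto simp: pd_def linear_cmul fun_eq_iff)
  ultimately show ?thesis by (simp add: has_field_derivative_def)
qed

text \<open>By translation invariance every difference quotient of \<open>f\<close> has integral zero. The quotients are
  bounded, by the mean value theorem, and vanish outside a fixed compact set, so the limit may be
  taken under the integral. This avoids iterated integrals.\<close>

lemma integral_pd_eq_0:
  fixes f :: scalar_fun
  assumes diff: "\<And>x. f differentiable at x" and cont: "continuous_on UNIV (pd i f)"
    and C: "compact C" "\<And>x. x \<notin> C \<Longrightarrow> f x = 0"
  shows "(LINT x|lborel. pd i f x) = 0"
proof -
  let ?e = "axis i (1::real) :: pt"
  define h where "h n = inverse (real (Suc n))" for n
  have h: "0 < h n" "h n \<le> 1" for n by (auto simp: h_def inverse_le_1_iff)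
  define D where "D n x = (f (x + h n *\<^sub>R ?e) - f x) / h n" for n x
  have contf: "continuous_on UNIV f"
    by (meson continuous_at_imp_continuous_on diff differentiable_imp_continuous_within)
  have intf: "integrable lborel f"
    by (rule integrable_compact_support[OF contf C])
  have shift: "integrable lborel (\<lambda>x. f (v + x))" "(LINT x|lborel. f (v + x)) = (LINT x|lborel. f x)"
    for v
  proof -
    show "integrable lborel (\<lambda>x. f (v + x))"
      by (rule integrable_distr[of "(+) v" lborel borel f])
        (simp_all add: lborel_distr_plus intf)
    have "(LINT x|lborel. f x) = (LINT x|distr lborel borel ((+) v). f x)"
      by (simp add: lborel_distr_plus)
    also have "\<dots> = (LINT x|lborel. f (v + x))"
      using borel_measurable_integrable[OF intf] by (subst integral_distr) auto
    finally show "(LINT x|lborel. f (v + x)) = (LINT x|lborel. f x)" by simp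
  qed
  have int_D: "integrable lborel (D n)" "(LINT x|lborel. D n x) = 0" for n
    using shift[of "h n *\<^sub>R ?e"] intf by (auto simp: D_def[abs_def] add.commute)
  obtain M where M: "\<And>x. x \<in> C \<Longrightarrow> \<bar>pd i f x\<bar> \<le> M"
    using compact_imp_bounded[OF compact_continuous_image[OF continuous_on_subset[OF cont] C(1)]]
    by (auto simp: bounded_iff)
  \<comment> \<open>All steps are at most \<open>1\<close>, so every difference quotient is supported in the unit neighbourhood of \<open>C\<close>.\<close>
  define C' where "C' = {x - y |x y. x \<in> C \<and> y \<in> cball (0::pt) 1}"
  have C': "compact C'"
    unfolding C'_def by (rule compact_differences) (use C in auto)
  have "(\<lambda>n. LINT x|lborel. D n x) \<longlonglongrightarrow> (LINT x|lborel. pd i f x)"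
  proof (rule integral_dominated_convergence)
    show "pd i f \<in> borel_measurable lborel"
      using cont by (simp add: borel_measurable_continuous_onI)
    show "D n \<in> borel_measurable lborel" for n
      using int_D by blast
    show "integrable lborel (\<lambda>x. indicator C' x *\<^sub>R M)"
      using C' by (intro borel_integrable_compact) auto
    show "AE x in lborel. (\<lambda>n. D n x) \<longlonglongrightarrow> pd i f x"
    proof (rule AE_I2)
      fix x
      have "((\<lambda>h. (f (x + h *\<^sub>R ?e) - f x) / h) \<longlongrightarrow> pd i f x) (at 0)"
        using line_has_derivative_pd[OF diff, of x i 0] by (simp add: has_field_derivative_iff)
      moreover have "filterlim h (at 0) sequentially"
        using LIMSEQ_inverse_real_of_nat h by (intro filterlim_atI) (auto simp: h_def[abs_def])
      ultimately show "(\<lambda>n. D n x) \<longlonglongrightarrow> pd i f x"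
        unfolding D_def by (rule filterlim_compose)
    qed
    show "AE x in lborel. norm (D n x) \<le> indicator C' x *\<^sub>R M" for n
    proof (rule AE_I2)
      fix x
      obtain z where z: "0 < z" "z < h n"
        and "f (x + h n *\<^sub>R ?e) - f (x + 0 *\<^sub>R ?e) = (h n - 0) * pd i f (x + z *\<^sub>R ?e)"
        using MVT2[OF h(1)[of n], of "\<lambda>t. f (x + t *\<^sub>R ?e)" "\<lambda>t. pd i f (x + t *\<^sub>R ?e)"]
          line_has_derivative_pd[OF diff] by metis
      then have D: "D n x = pd i f (x + z *\<^sub>R ?e)"
        using h(1)[of n] by (simp add: D_def)
      show "norm (D n x) \<le> indicator C' x *\<^sub>R M"
      proof (cases "x + z *\<^sub>R ?e \<in> C")
        case True
        then have "x \<in> C'"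
          unfolding C'_def using z h(2)[of n]
          by (intro CollectI exI[of _ "x + z *\<^sub>R ?e"] exI[of _ "z *\<^sub>R ?e"]) auto
        with True show ?thesis by (simp add: D M)
      next
        case False
        then have "D n x = 0"
          using pd_eq_0_outside[where f = f, OF compact_imp_closed[OF C(1)] C(2)] by (simp add: D)
        moreover have "x \<in> C' \<Longrightarrow> 0 \<le> M"
          using M unfolding C'_def by (smt (verit) mem_Collect_eq abs_ge_zero)
        ultimately show ?thesis by (auto simp: indicator_def)
      qed
    qed
  qed
  then show ?thesis by (simp add: int_D LIMSEQ_const_iff)
qed

text \<open>The total derivative of the product has compact support and hence integral zero.\<close>

lemma integration_by_parts:
  assumes f: "\<And>x. f differentiable at x" "continuous_on UNIV (pd i f)"
    and \<phi>: "\<phi> \<in> test_functions U"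
  shows "(LINT x|lborel. f x * pd i \<phi> x) = - (LINT x|lborel. pd i f x * \<phi> x)"
proof -
  obtain C where C: "compact C" "C \<subseteq> U" "\<And>x. x \<notin> C \<Longrightarrow> \<phi> x = 0"
    using test_function_support[OF \<phi>] by blast
  have dC: "pd i \<phi> x = 0" if "x \<notin> C" for x
    by (rule pd_eq_0_outside[where f = \<phi>, OF compact_imp_closed[OF C(1)] C(3) that])
  have contf: "continuous_on UNIV f"
    by (meson continuous_at_imp_continuous_on f(1) differentiable_imp_continuous_within)
  have c: "continuous_on UNIV (\<lambda>x. f x * pd i \<phi> x)" "continuous_on UNIV (\<lambda>x. pd i f x * \<phi> x)"
    using contf f(2) test_function_smooth[OF \<phi>] by (auto intro!: continuous_intros)
  have der: "((\<lambda>x. f x * \<phi> x) has_derivative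
      (\<lambda>h. f x * frechet_derivative \<phi> (at x) h + frechet_derivative f (at x) h * \<phi> x)) (at x)" for x
    using f(1) test_function_smooth(1)[OF \<phi>]
    by (intro has_derivative_mult) (auto simp: frechet_derivative_works)
  have pd: "pd i (\<lambda>x. f x * \<phi> x) = (\<lambda>x. f x * pd i \<phi> x + pd i f x * \<phi> x)"
    using pd_eqI[OF der] by (auto simp: pd_def)
  have "(LINT x|lborel. pd i (\<lambda>x. f x * \<phi> x) x) = 0"
  proof (rule integral_pd_eq_0[OF _ _ C(1)])
    show "(\<lambda>x. f x * \<phi> x) differentiable at x" for x
      using der differentiable_def by blast
    show "continuous_on UNIV (pd i (\<lambda>x. f x * \<phi> x))"
      unfolding pd using c by (intro continuous_on_add)
  qed (use C in auto)
  moreover have "integrable lborel (\<lambda>x. f x * pd i \<phi> x)" "integrable lborel (\<lambda>x. pd i f x * \<phi> x)"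
    using c C dC by (auto intro: integrable_compact_support)
  ultimately show ?thesis unfolding pd by simp
qed

lemma continuous_imp_L2:
  fixes f :: scalar_fun
  assumes "bounded S" "S \<in> sets lebesgue" "continuous_on UNIV f"
  shows "f \<in> L2 S"
proof -
  interpret finite_measure "lebesgue_on S"
    by (rule finite_measure_lebesgue_on) (use assms in \<open>auto intro: bounded_set_imp_lmeasurable\<close>)
  have meas: "f \<in> borel_measurable (lebesgue_on S)"
    by (meson assms continuous_imp_measurable_on_sets_lebesgue continuous_on_subset subset_UNIV)
  have "compact ((\<lambda>x. (f x)\<^sup>2) ` closure S)"
    using assms by (intro compact_continuous_image continuous_intros)
      (auto intro: continuous_on_subset)
  from compact_imp_bounded[OF this] obtain B where B: "\<forall>y\<in>(\<lambda>x. (f x)\<^sup>2) ` closure S. norm y \<le> B"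
    unfolding bounded_iff by blast
  then have "norm ((f x)\<^sup>2) \<le> B" if "x \<in> S" for x
    using B subsetD[OF closure_subset that] by blast
  then have "integrable (lebesgue_on S) (\<lambda>x. (f x)\<^sup>2)"
    using meas by (intro integrable_const_bound[of _ B] AE_I2) auto
  with meas show ?thesis by (simp add: L2_def)
qed

lemma L2_inner_eq_lborel:
  assumes "S \<in> sets lebesgue" "continuous_on UNIV f" "continuous_on UNIV g" "\<And>x. x \<notin> S \<Longrightarrow> g x = 0"
  shows "L2_inner S f g = (LINT x|lborel. f x * g x)"
proof -
  have "L2_inner S f g = (LINT x|lebesgue. (if x \<in> S then f x * g x else 0))"
    unfolding L2_inner_def by (rule Lebesgue_Measure.integral_restrict_UNIV[OF assms(1), symmetric])
  also have "(\<lambda>x. if x \<in> S then f x * g x else 0) = (\<lambda>x. f x * g x)"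
    using assms(4) by auto
  also have "integral\<^sup>L lebesgue (\<lambda>x. f x * g x) = (LINT x|lborel. f x * g x)"
    using assms(2,3) by (intro integral_completion)
      (simp add: borel_measurable_continuous_onI borel_measurable_times)
  finally show ?thesis .
qed

lemma has_weak_pd_classical:
  assumes \<Omega>: "open \<Omega>" "bounded \<Omega>"
    and f: "\<And>x. f differentiable at x" "continuous_on UNIV (pd i f)"
  shows "has_weak_pd \<Omega> i f (pd i f)"
proof -
  have contf: "continuous_on UNIV f"
    by (meson continuous_at_imp_continuous_on f(1) differentiable_imp_continuous_within)
  have \<Omega>m: "\<Omega> \<in> sets lebesgue" using \<Omega>(1) by (simp add: borel_open)
  have "L2_inner \<Omega> f (pd i \<phi>) = - L2_inner \<Omega> (pd i f) \<phi>" if \<phi>: "\<phi> \<in> test_functions \<Omega>" for \<phi>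
  proof -
    have zero: "\<psi> x = 0" if "\<psi> \<in> test_functions \<Omega>" "x \<notin> \<Omega>" for \<psi> x
      using that test_function_support by blast
    have "L2_inner \<Omega> f (pd i \<phi>) = (LINT x|lborel. f x * pd i \<phi> x)"
      using zero[OF test_function_pd[OF \<phi>]] test_function_smooth[OF \<phi>] contf \<Omega>m
      by (intro L2_inner_eq_lborel) auto
    also have "\<dots> = - (LINT x|lborel. pd i f x * \<phi> x)"
      by (rule integration_by_parts[OF f \<phi>])
    also have "(LINT x|lborel. pd i f x * \<phi> x) = L2_inner \<Omega> (pd i f) \<phi>"
      using zero[OF \<phi>] test_function_smooth[OF \<phi>] f(2) \<Omega>m
      by (intro L2_inner_eq_lborel[symmetric]) auto
    finally show ?thesis .
  qed
  then show ?thesis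
    unfolding has_weak_pd_def using continuous_imp_L2 \<Omega>(2) \<Omega>m contf f(2) by blast
qed

section \<open>The fundamental lemma of the calculus of variations\<close>

lemma L2_integrable:
  assumes "bounded S" "S \<in> sets lebesgue" "f \<in> L2 S"
  shows "integrable (lebesgue_on S) f"
  using L2_mult_integrable[OF assms(3) continuous_imp_L2[OF assms(1,2), of "\<lambda>x. 1"]] by simp

text \<open>Dominated convergence along the bump functions shows that the integral of \<open>g\<close> over every box inside
  \<open>U\<close> vanishes; almost every value of \<open>g\<close> is a limit of its averages over small boxes.\<close>

lemma fundamental_lemma:
  assumes U: "open U" "bounded U" and g: "g \<in> L2 U"
    and zero: "\<And>\<phi>. \<phi> \<in> test_functions U \<Longrightarrow> L2_inner U g \<phi> = 0"
  shows "ae_eq U g (\<lambda>x. 0)"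
proof -
  have Um: "U \<in> sets lebesgue" using U(1) by (simp add: borel_open)
  have ig: "integrable (lebesgue_on U) g" by (rule L2_integrable[OF U(2) Um g])
  have int_box: "(g has_integral 0) (cbox a b)" if ab: "cbox a b \<subseteq> U" for a b
  proof -
    let ?b = "\<lambda>n. bump a b (inverse (real (Suc n)))"
    have test: "?b n \<in> test_functions U" for n
      by (rule bump_test_function[OF _ ab]) simp
    have meas_b: "?b n \<in> borel_measurable (lebesgue_on U)" for n
      using test_function_smooth(2)[OF test] Um
      by (meson continuous_imp_measurable_on_sets_lebesgue)
    have meas_box: "(indicator (box a b) :: pt \<Rightarrow> real) \<in> borel_measurable (lebesgue_on U)"
      by (intro measurable_restrict_space1 borel_measurable_indicator) simp
    have lim: "(\<lambda>n. LINT x|lebesgue_on U. g x * ?b n x) \<longlonglongrightarrow>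
        (LINT x|lebesgue_on U. g x * indicator (box a b) x)"
    proof (rule integral_dominated_convergence[where w="\<lambda>x. norm (g x)"])
      show "AE x in lebesgue_on U. (\<lambda>n. g x * ?b n x) \<longlonglongrightarrow> g x * indicator (box a b) x"
        by (intro AE_I2 tendsto_mult tendsto_const bump_tendsto_indicator)
      show "AE x in lebesgue_on U. norm (g x * ?b n x) \<le> norm (g x)" for n
        using bump_bounds[of "inverse (real (Suc n))" a b]
        by (intro AE_I2) (auto simp: abs_mult intro!: mult_left_le)
    qed (use ig meas_b meas_box in auto)
    moreover have "(LINT x|lebesgue_on U. g x * ?b n x) = 0" for n
      using zero[OF test] by (simp add: L2_inner_def)
    ultimately have I0: "(LINT x|lebesgue_on U. g x * indicator (box a b) x) = 0"
      by (simp add: LIMSEQ_const_iff)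
    have "integrable (lebesgue_on U) (\<lambda>x. g x * indicator (box a b) x)"
    proof (rule Bochner_Integration.integrable_bound[OF ig])
      show "(\<lambda>x. g x * indicator (box a b) x) \<in> borel_measurable (lebesgue_on U)"
        using ig meas_box by (intro borel_measurable_times) auto
    qed (auto simp: indicator_def)
    from has_integral_integral_lebesgue_on[OF this Um]
    have "((\<lambda>x. g x * indicator (box a b) x) has_integral 0) U" by (simp add: I0)
    then have "((\<lambda>x. if x \<in> box a b then g x else 0) has_integral 0) U"
      by (rule has_integral_eq[rotated]) auto
    then have "(g has_integral 0) (box a b)"
      using ab box_subset_cbox by (subst (asm) has_integral_restrict) auto
    then show ?thesis by (simp add: has_integral_open_interval)
  qed
  define f where "f x = (if x \<in> U then g x else 0)" for x
  have "f integrable_on cbox a b" for a b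
  proof -
    have "f integrable_on UNIV"
      unfolding f_def integrable_restrict_UNIV
      by (rule integrable_on_lebesgue_on[OF ig Um])
    then show ?thesis using integrable_on_subcbox by blast
  qed
  then obtain N where N: "negligible N" and dense: "\<And>x e. \<lbrakk>x \<notin> N; 0 < e\<rbrakk> \<Longrightarrow>
      \<exists>d>0. \<forall>h. 0 < h \<and> h < d \<longrightarrow>
        norm (integral (cbox x (x + h *\<^sub>R One)) f /\<^sub>R h ^ DIM(pt) - f x) < e"
    using integrable_ccontinuous_explicit[of f] by blast
  have "g x = 0" if x: "x \<in> U" "x \<notin> N" for x
  proof (rule ccontr)
    assume "g x \<noteq> 0"
    then have "0 < \<bar>g x\<bar>" by simp
    from dense[OF x(2) this] obtain d where d: "d > 0"
      "\<And>h. \<lbrakk>0 < h; h < d\<rbrakk> \<Longrightarrow>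
         norm (integral (cbox x (x + h *\<^sub>R One)) f /\<^sub>R h ^ DIM(pt) - f x) < \<bar>g x\<bar>"
      by blast
    obtain r where r: "r > 0" "ball x r \<subseteq> U"
      using U(1) x(1) openE by blast
    \<comment> \<open>In the plane, a box of side \<open>h\<close> lies within distance \<open>2 * h\<close> of its corner.\<close>
    define h where "h = min (d / 2) (r / 3)"
    have h: "0 < h" "h < d" "2 * h < r" using d(1) r(1) by (auto simp: h_def)
    have "cbox x (x + h *\<^sub>R One) \<subseteq> ball x r"
    proof
      fix y assume y: "y \<in> cbox x (x + h *\<^sub>R One)"
      have "norm (y - x) \<le> (\<Sum>b\<in>Basis. \<bar>(y - x) \<bullet> b\<bar>)" by (rule norm_le_l1)
      also have "\<dots> \<le> (\<Sum>b\<in>(Basis :: pt set). h)"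
        using y by (intro sum_mono) (auto simp: mem_box inner_diff_left inner_add_left)
      also have "\<dots> = 2 * h" by simp
      finally show "y \<in> ball x r" using h(3) by (simp add: dist_norm norm_minus_commute)
    qed
    then have sub: "cbox x (x + h *\<^sub>R One) \<subseteq> U" using r(2) by blast
    have "integral (cbox x (x + h *\<^sub>R One)) f = integral (cbox x (x + h *\<^sub>R One)) g"
      by (rule integral_cong) (use sub in \<open>auto simp: f_def\<close>)
    also have "\<dots> = 0" using int_box[OF sub] by (rule integral_unique)
    finally show False using d(2)[OF h(1,2)] x(1) by (simp add: f_def)
  qed
  then have "{x \<in> U. \<not> g x = 0} \<subseteq> N" by blast
  then show ?thesis
    unfolding ae_eq_def AE_lebesgue_on_iff_negligible[OF Um]
    using N negligible_subset by blast
qed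

section \<open>Calculus of weak derivatives\<close>

locale bounded_open =
  fixes \<Omega> :: "pt set"
  assumes open_\<Omega>: "open \<Omega>" and bounded_\<Omega>: "bounded \<Omega>"
begin

lemma \<Omega>_sets [simp]: "\<Omega> \<in> sets lebesgue"
  using open_\<Omega> by (simp add: borel_open)

lemma test_function_L2: "\<phi> \<in> test_functions \<Omega> \<Longrightarrow> \<phi> \<in> L2 \<Omega>"
  by (intro continuous_imp_L2 bounded_\<Omega> \<Omega>_sets test_function_smooth(2))

text \<open>Everything about the chosen representative \<open>weak_pd\<close>, including its linearity, rests on this.\<close>

lemma weak_pd_unique:
  assumes "has_weak_pd \<Omega> i u g" "has_weak_pd \<Omega> i u h"
  shows "ae_eq \<Omega> g h"
proof -
  have L2: "g \<in> L2 \<Omega>" "h \<in> L2 \<Omega>" using assms by (auto simp: has_weak_pd_def)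
  have "ae_eq \<Omega> (\<lambda>x. g x + (- 1) * h x) (\<lambda>x. 0)"
  proof (rule fundamental_lemma[OF open_\<Omega> bounded_\<Omega> L2_lincomb[OF L2]])
    fix \<phi> assume \<phi>: "\<phi> \<in> test_functions \<Omega>"
    then show "L2_inner \<Omega> (\<lambda>x. g x + (- 1) * h x) \<phi> = 0"
      using assms L2_inner_lincomb_left[OF L2 test_function_L2[OF \<phi>], of "- 1"]
      by (auto simp: has_weak_pd_def)
  qed
  then show ?thesis unfolding ae_eq_def by auto
qed

lemma has_weak_pd_weak_pd: "has_weak_pd \<Omega> i u g \<Longrightarrow> has_weak_pd \<Omega> i u (weak_pd \<Omega> i u)"
  unfolding weak_pd_def by (rule someI[where P = "has_weak_pd \<Omega> i u"])

lemma weak_pd_ae_eq: "has_weak_pd \<Omega> i u g \<Longrightarrow> ae_eq \<Omega> (weak_pd \<Omega> i u) g"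
  using weak_pd_unique has_weak_pd_weak_pd by blast

lemma has_weak_pd_cong:
  assumes "ae_eq \<Omega> u u'" "ae_eq \<Omega> g g'" "has_weak_pd \<Omega> i u g"
  shows "has_weak_pd \<Omega> i u' g'"
proof -
  have L2: "u \<in> L2 \<Omega>" "g \<in> L2 \<Omega>" using assms(3) by (auto simp: has_weak_pd_def)
  have "L2_inner \<Omega> u' (pd i \<phi>) = L2_inner \<Omega> u (pd i \<phi>)" "L2_inner \<Omega> g' \<phi> = L2_inner \<Omega> g \<phi>"
    if "\<phi> \<in> test_functions \<Omega>" for \<phi>
    using that assms L2 test_function_L2 test_function_pd ae_eq_refl
    by (auto intro!: L2_inner_ae_eq)
  then show ?thesis
    using assms L2 L2_ae_eq[OF \<Omega>_sets] by (auto simp: has_weak_pd_def)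
qed

text \<open>Almost everywhere equal functions have literally the same set of weak derivatives, so the choice
  operator selects the same representative for both.\<close>

lemma weak_pd_cong:
  assumes "ae_eq \<Omega> u u'"
  shows "weak_pd \<Omega> i u = weak_pd \<Omega> i u'"
proof -
  have "has_weak_pd \<Omega> i u g = has_weak_pd \<Omega> i u' g" for g
    using has_weak_pd_cong[OF _ ae_eq_refl] assms ae_eq_sym by blast
  then show ?thesis by (simp add: weak_pd_def)
qed

lemma has_weak_pd_lincomb:
  assumes "has_weak_pd \<Omega> i u g" "has_weak_pd \<Omega> i v h"
  shows "has_weak_pd \<Omega> i (\<lambda>x. u x + c * v x) (\<lambda>x. g x + c * h x)"
proof -
  have L2: "u \<in> L2 \<Omega>" "g \<in> L2 \<Omega>" "v \<in> L2 \<Omega>" "h \<in> L2 \<Omega>"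
    using assms by (auto simp: has_weak_pd_def)
  have "L2_inner \<Omega> (\<lambda>x. u x + c * v x) (pd i \<phi>) = - L2_inner \<Omega> (\<lambda>x. g x + c * h x) \<phi>"
    if \<phi>: "\<phi> \<in> test_functions \<Omega>" for \<phi>
    unfolding L2_inner_lincomb_left[OF L2(1,3) test_function_L2[OF test_function_pd[OF \<phi>]]]
      L2_inner_lincomb_left[OF L2(2,4) test_function_L2[OF \<phi>]]
    using assms \<phi> by (simp add: has_weak_pd_def)
  then show ?thesis using L2 L2_lincomb by (simp add: has_weak_pd_def)
qed

lemma has_weak_pd_test_function:
  "\<phi> \<in> test_functions \<Omega> \<Longrightarrow> has_weak_pd \<Omega> i \<phi> (pd i \<phi>)"
  by (intro has_weak_pd_classical open_\<Omega> bounded_\<Omega> test_function_smooth)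

lemma sobolev_1_iff: "u \<in> sobolev \<Omega> 1 \<longleftrightarrow> (\<forall>i. has_weak_pd \<Omega> i u (weak_pd \<Omega> i u))"
proof -
  have "has_weak_pd \<Omega> i u g \<Longrightarrow> u \<in> L2 \<Omega> \<and> g \<in> L2 \<Omega>" for i g
    by (simp add: has_weak_pd_def)
  then show ?thesis
    unfolding One_nat_def sobolev.simps using has_weak_pd_weak_pd by blast
qed

lemma sobolev_1_has_weak_pd: "u \<in> sobolev \<Omega> 1 \<Longrightarrow> has_weak_pd \<Omega> i u (weak_pd \<Omega> i u)"
  using sobolev_1_iff by blast

lemma sobolev_1_L2: "u \<in> sobolev \<Omega> 1 \<Longrightarrow> u \<in> L2 \<Omega>" "u \<in> sobolev \<Omega> 1 \<Longrightarrow> weak_pd \<Omega> i u \<in> L2 \<Omega>"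
  using sobolev_1_has_weak_pd[of u i] by (auto simp: has_weak_pd_def)

lemma sobolev_1I: "(\<And>i. has_weak_pd \<Omega> i u (g i)) \<Longrightarrow> u \<in> sobolev \<Omega> 1"
  using sobolev_1_iff has_weak_pd_weak_pd by blast

lemma sobolev_1_cong: "ae_eq \<Omega> u u' \<Longrightarrow> u \<in> sobolev \<Omega> 1 \<Longrightarrow> u' \<in> sobolev \<Omega> 1"
  using sobolev_1_has_weak_pd has_weak_pd_cong[OF _ ae_eq_refl] by (intro sobolev_1I) blast

lemma sobolev_1_lincomb:
  "u \<in> sobolev \<Omega> 1 \<Longrightarrow> v \<in> sobolev \<Omega> 1 \<Longrightarrow> (\<lambda>x. u x + c * v x) \<in> sobolev \<Omega> 1"
  using has_weak_pd_lincomb[OF sobolev_1_has_weak_pd sobolev_1_has_weak_pd] by (intro sobolev_1I)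

lemma weak_pd_lincomb:
  "u \<in> sobolev \<Omega> 1 \<Longrightarrow> v \<in> sobolev \<Omega> 1 \<Longrightarrow>
     ae_eq \<Omega> (weak_pd \<Omega> i (\<lambda>x. u x + c * v x)) (\<lambda>x. weak_pd \<Omega> i u x + c * weak_pd \<Omega> i v x)"
  by (intro weak_pd_ae_eq has_weak_pd_lincomb sobolev_1_has_weak_pd)

lemma test_function_sobolev_1: "\<phi> \<in> test_functions \<Omega> \<Longrightarrow> \<phi> \<in> sobolev \<Omega> 1"
  using has_weak_pd_test_function by (rule sobolev_1I)

lemma sobolev_2D:
  assumes "u \<in> sobolev \<Omega> 2"
  shows "u \<in> sobolev \<Omega> 1" "weak_pd \<Omega> i u \<in> sobolev \<Omega> 1"
proof -
  have "\<exists>g\<in>sobolev \<Omega> 1. has_weak_pd \<Omega> i u g" for i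
    using assms unfolding numeral_2_eq_2 sobolev.simps(2)[of \<Omega> "Suc 0"] by simp
  then obtain g where g: "\<And>i. g i \<in> sobolev \<Omega> 1" "\<And>i. has_weak_pd \<Omega> i u (g i)" by metis
  show "u \<in> sobolev \<Omega> 1" by (rule sobolev_1I[OF g(2)])
  show "weak_pd \<Omega> i u \<in> sobolev \<Omega> 1"
    by (rule sobolev_1_cong[OF ae_eq_sym[OF weak_pd_ae_eq[OF g(2)]] g(1)])
qed

lemma L2_inner_restrict:
  assumes "U \<subseteq> \<Omega>" "U \<in> sets lebesgue" "\<And>x. x \<notin> U \<Longrightarrow> f x * g x = 0"
  shows "L2_inner \<Omega> f g = L2_inner U f g"
proof -
  have "(\<lambda>x. f x * g x) = (\<lambda>x. if x \<in> U then f x * g x else 0)"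
    using assms(3) by auto
  then show ?thesis
    unfolding L2_inner_def
    using integral_restrict[OF assms(1,2) \<Omega>_sets, of "\<lambda>x. f x * g x"] by simp
qed

lemma L2_restrict:
  assumes "U \<subseteq> \<Omega>" "U \<in> sets lebesgue" "f \<in> L2 \<Omega>"
  shows "f \<in> L2 U"
proof -
  have "f \<in> borel_measurable (lebesgue_on U)"
    using assms by (auto simp: L2_def intro: measurable_restrict_mono)
  moreover have "integrable (lebesgue_on U) (\<lambda>x. (f x)\<^sup>2)"
  proof -
    let ?f = "\<lambda>x. if x \<in> \<Omega> then (f x)\<^sup>2 else 0"
    have "integrable lebesgue ?f"
      using assms(3) by (simp add: L2_def Lebesgue_Measure.integrable_restrict_UNIV)
    from integrable_mult_indicator[OF assms(2) this]
    have "integrable lebesgue (\<lambda>x. indicator U x *\<^sub>R ?f x)" .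
    also have "(\<lambda>x. indicator U x *\<^sub>R ?f x) = (\<lambda>x. if x \<in> U then (f x)\<^sup>2 else 0)"
      using assms(1) by (auto simp: fun_eq_iff)
    finally show ?thesis using assms(2) by (simp add: Lebesgue_Measure.integrable_restrict_UNIV)
  qed
  ultimately show ?thesis by (simp add: L2_def)
qed

text \<open>A test function on \<open>U\<close> is one on \<open>\<Omega>\<close>, so weak derivatives restrict to open subsets. On \<open>U\<close> the
  classical derivative is a competitor, and uniqueness applies.\<close>

lemma weak_pd_on_open:
  assumes U: "open U" "U \<subseteq> \<Omega>" and u: "u \<in> sobolev \<Omega> 1" and eq: "ae_eq U u p"
    and p: "\<And>x. p differentiable at x" "continuous_on UNIV (pd i p)"
  shows "ae_eq U (weak_pd \<Omega> i u) (pd i p)"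
proof -
  have Um: "U \<in> sets lebesgue" using U(1) by (simp add: borel_open)
  interpret U: bounded_open U
    using U bounded_\<Omega> bounded_subset by unfold_locales auto
  have w: "has_weak_pd \<Omega> i u (weak_pd \<Omega> i u)" by (rule sobolev_1_has_weak_pd[OF u])
  have "has_weak_pd U i u (weak_pd \<Omega> i u)"
    unfolding has_weak_pd_def
  proof (intro conjI ballI)
    show "u \<in> L2 U" "weak_pd \<Omega> i u \<in> L2 U"
      using w L2_restrict[OF U(2) Um] by (auto simp: has_weak_pd_def)
    fix \<phi> assume \<phi>: "\<phi> \<in> test_functions U"
    have zero: "\<psi> x = 0" if "\<psi> \<in> test_functions U" "x \<notin> U" for \<psi> x
      using that test_function_support by blast
    have "L2_inner \<Omega> u (pd i \<phi>) = - L2_inner \<Omega> (weak_pd \<Omega> i u) \<phi>"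
      using w test_function_mono[OF U(2) \<phi>] by (simp add: has_weak_pd_def)
    then show "L2_inner U u (pd i \<phi>) = - L2_inner U (weak_pd \<Omega> i u) \<phi>"
      using L2_inner_restrict[OF U(2) Um] zero[OF \<phi>] zero[OF test_function_pd[OF \<phi>]] by simp
  qed
  moreover have "has_weak_pd U i u (pd i p)"
    by (rule U.has_weak_pd_cong[OF ae_eq_sym[OF eq] ae_eq_refl has_weak_pd_classical])
      (use U.open_\<Omega> U.bounded_\<Omega> p in auto)
  ultimately show ?thesis by (rule U.weak_pd_unique)
qed

lemma L2_inner_lincomb_le:
  assumes "f \<in> L2 S" "g \<in> L2 S"
  shows "L2_inner S (\<lambda>x. f x + c * g x) (\<lambda>x. f x + c * g x)
     \<le> 2 * L2_inner S f f + 2 * c\<^sup>2 * L2_inner S g g"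
proof -
  have i: "integrable (lebesgue_on S) (\<lambda>x. f x * f x)" "integrable (lebesgue_on S) (\<lambda>x. g x * g x)"
    using L2_mult_integrable assms by blast+
  have "L2_inner S (\<lambda>x. f x + c * g x) (\<lambda>x. f x + c * g x)
     \<le> (LINT x|lebesgue_on S. 2 * (f x * f x) + 2 * c\<^sup>2 * (g x * g x))"
    unfolding L2_inner_def
  proof (rule integral_mono)
    show "(f x + c * g x) * (f x + c * g x) \<le> 2 * (f x * f x) + 2 * c\<^sup>2 * (g x * g x)" for x
      using zero_le_square[of "f x - c * g x"] by (simp add: power2_eq_square algebra_simps)
  qed (use i L2_mult_integrable[OF L2_lincomb[OF assms] L2_lincomb[OF assms]] in auto)
  also have "\<dots> = 2 * L2_inner S f f + 2 * c\<^sup>2 * L2_inner S g g"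
    using i by (simp add: L2_inner_def)
  finally show ?thesis .
qed

lemma sobolev_norm_sq_1:
  "sobolev_norm_sq \<Omega> 1 u
     = L2_inner \<Omega> u u + (\<Sum>i\<in>UNIV. L2_inner \<Omega> (weak_pd \<Omega> i u) (weak_pd \<Omega> i u))"
  by simp

lemma sobolev_norm_sq_nonneg: "0 \<le> sobolev_norm_sq \<Omega> m u"
  by (induction m arbitrary: u) (auto intro!: add_nonneg_nonneg sum_nonneg L2_inner_self_nonneg)

lemma sobolev_norm_sq_1_cong:
  assumes "u \<in> L2 \<Omega>" "ae_eq \<Omega> u u'"
  shows "sobolev_norm_sq \<Omega> 1 u' = sobolev_norm_sq \<Omega> 1 u"
  unfolding sobolev_norm_sq_1 weak_pd_cong[OF assms(2)]
  using L2_inner_ae_eq[OF \<Omega>_sets assms(1,1,2,2)] by simp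

lemma sobolev_norm_sq_1_lincomb_le:
  assumes "u \<in> sobolev \<Omega> 1" "v \<in> sobolev \<Omega> 1"
  shows "sobolev_norm_sq \<Omega> 1 (\<lambda>x. u x + c * v x)
     \<le> 2 * sobolev_norm_sq \<Omega> 1 u + 2 * c\<^sup>2 * sobolev_norm_sq \<Omega> 1 v"
proof -
  have "L2_inner \<Omega> (weak_pd \<Omega> i (\<lambda>x. u x + c * v x)) (weak_pd \<Omega> i (\<lambda>x. u x + c * v x))
      \<le> 2 * L2_inner \<Omega> (weak_pd \<Omega> i u) (weak_pd \<Omega> i u)
        + 2 * c\<^sup>2 * L2_inner \<Omega> (weak_pd \<Omega> i v) (weak_pd \<Omega> i v)" (is "?l i \<le> ?r i") for i
  proof -
    note L2 = sobolev_1_L2(2)[OF assms(1), of i] sobolev_1_L2(2)[OF assms(2), of i]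
    have eq: "ae_eq \<Omega> (\<lambda>x. weak_pd \<Omega> i u x + c * weak_pd \<Omega> i v x)
        (weak_pd \<Omega> i (\<lambda>x. u x + c * v x))"
      using weak_pd_lincomb assms ae_eq_sym by blast
    have L: "(\<lambda>x. weak_pd \<Omega> i u x + c * weak_pd \<Omega> i v x) \<in> L2 \<Omega>" by (rule L2_lincomb[OF L2])
    show ?thesis
      unfolding L2_inner_ae_eq[OF \<Omega>_sets L L eq eq] by (rule L2_inner_lincomb_le[OF L2])
  qed
  then have "(\<Sum>i\<in>UNIV. ?l i) \<le> (\<Sum>i\<in>UNIV. ?r i)" by (rule sum_mono)
  moreover have "L2_inner \<Omega> (\<lambda>x. u x + c * v x) (\<lambda>x. u x + c * v x)
     \<le> 2 * L2_inner \<Omega> u u + 2 * c\<^sup>2 * L2_inner \<Omega> v v"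
    by (rule L2_inner_lincomb_le[OF sobolev_1_L2(1)[OF assms(1)] sobolev_1_L2(1)[OF assms(2)]])
  ultimately show ?thesis
    unfolding sobolev_norm_sq_1 by (simp add: sum.distrib sum_distrib_left distrib_left)
qed

lemma sobolev_0_1_lincomb:
  assumes u: "u \<in> sobolev_0 \<Omega> 1" and v: "v \<in> sobolev_0 \<Omega> 1"
  shows "(\<lambda>x. u x + c * v x) \<in> sobolev_0 \<Omega> 1"
proof -
  have uv: "u \<in> sobolev \<Omega> 1" "v \<in> sobolev \<Omega> 1" using assms by (auto simp: sobolev_0_def)
  have "\<exists>\<eta>\<in>test_functions \<Omega>. sqrt (sobolev_norm_sq \<Omega> 1 (\<lambda>x. u x + c * v x - \<eta> x)) < \<epsilon>"
    if eps: "\<epsilon> > 0" for \<epsilon>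
  proof -
    \<comment> \<open>Small enough that \<open>2 * \<delta>\<^sup>2 + 2 * c\<^sup>2 * \<delta>\<^sup>2 < \<epsilon>\<^sup>2\<close>.\<close>
    define \<delta> where "\<delta> = \<epsilon> / (2 * (1 + \<bar>c\<bar>))"
    have \<delta>: "\<delta> > 0" using eps by (simp add: \<delta>_def)
    obtain \<phi> where \<phi>: "\<phi> \<in> test_functions \<Omega>" "sqrt (sobolev_norm_sq \<Omega> 1 (\<lambda>x. u x - \<phi> x)) < \<delta>"
      using u \<delta> unfolding sobolev_0_def by blast
    obtain \<psi> where \<psi>: "\<psi> \<in> test_functions \<Omega>" "sqrt (sobolev_norm_sq \<Omega> 1 (\<lambda>x. v x - \<psi> x)) < \<delta>"
      using v \<delta> unfolding sobolev_0_def by blast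
    have sq: "sobolev_norm_sq \<Omega> 1 w \<le> \<delta>\<^sup>2" if "sqrt (sobolev_norm_sq \<Omega> 1 w) < \<delta>" for w
      using that by (meson less_imp_le sqrt_le_D)
    have H1: "(\<lambda>x. u x - \<phi> x) \<in> sobolev \<Omega> 1" "(\<lambda>x. v x - \<psi> x) \<in> sobolev \<Omega> 1"
      using sobolev_1_lincomb[OF uv(1) test_function_sobolev_1[OF \<phi>(1)], of "- 1"]
        sobolev_1_lincomb[OF uv(2) test_function_sobolev_1[OF \<psi>(1)], of "- 1"] by auto
    have "sobolev_norm_sq \<Omega> 1 (\<lambda>x. (u x - \<phi> x) + c * (v x - \<psi> x)) \<le> 2 * \<delta>\<^sup>2 + 2 * c\<^sup>2 * \<delta>\<^sup>2"
      by (rule order_trans[OF sobolev_norm_sq_1_lincomb_le[OF H1]])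
        (intro add_mono mult_left_mono sq \<phi>(2) \<psi>(2), auto)
    also have "\<dots> \<le> 2 * (\<delta> * (1 + \<bar>c\<bar>))\<^sup>2"
    proof -
      have "1 + c\<^sup>2 \<le> (1 + \<bar>c\<bar>)\<^sup>2" by (simp add: power2_eq_square algebra_simps)
      from mult_left_mono[OF this, of "2 * \<delta>\<^sup>2"] show ?thesis
        unfolding power_mult_distrib by (simp add: algebra_simps)
    qed
    also have "\<delta> * (1 + \<bar>c\<bar>) = \<epsilon> / 2" by (simp add: \<delta>_def field_simps)
    also have "2 * (\<epsilon> / 2)\<^sup>2 < \<epsilon>\<^sup>2" using eps by (simp add: power2_eq_square)
    finally have "sqrt (sobolev_norm_sq \<Omega> 1 (\<lambda>x. (u x - \<phi> x) + c * (v x - \<psi> x))) < sqrt (\<epsilon>\<^sup>2)"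
      by (rule real_sqrt_less_mono)
    moreover have "(\<lambda>x. (u x - \<phi> x) + c * (v x - \<psi> x)) = (\<lambda>x. u x + c * v x - (\<phi> x + c * \<psi> x))"
      by (simp add: algebra_simps)
    ultimately have "sqrt (sobolev_norm_sq \<Omega> 1 (\<lambda>x. u x + c * v x - (\<phi> x + c * \<psi> x))) < \<epsilon>"
      using eps by simp
    then show ?thesis using test_function_lincomb[OF \<phi>(1) \<psi>(1)] by (intro bexI) auto
  qed
  then show ?thesis using sobolev_1_lincomb[OF uv] by (simp add: sobolev_0_def del: sobolev.simps One_nat_def)
qed

text \<open>If test functions \<open>\<phi>\<close> approximate \<open>u\<close> in \<open>H\<^sup>2\<close>, then their derivatives, again test functions,
  approximate the derivative of \<open>u\<close> in \<open>H\<^sup>1\<close>.\<close>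

lemma sobolev_0_2_weak_pd:
  assumes "u \<in> sobolev_0 \<Omega> 2"
  shows "weak_pd \<Omega> i u \<in> sobolev_0 \<Omega> 1"
proof -
  have u: "u \<in> sobolev \<Omega> 2" using assms by (simp add: sobolev_0_def)
  have "\<exists>\<psi>\<in>test_functions \<Omega>. sqrt (sobolev_norm_sq \<Omega> 1 (\<lambda>x. weak_pd \<Omega> i u x - \<psi> x)) < \<epsilon>"
    if eps: "\<epsilon> > 0" for \<epsilon>
  proof -
    obtain \<phi> where \<phi>: "\<phi> \<in> test_functions \<Omega>" "sqrt (sobolev_norm_sq \<Omega> 2 (\<lambda>x. u x - \<phi> x)) < \<epsilon>"
      using assms eps unfolding sobolev_0_def by blast
    have "has_weak_pd \<Omega> i (\<lambda>x. u x + (- 1) * \<phi> x) (\<lambda>x. weak_pd \<Omega> i u x + (- 1) * pd i \<phi> x)"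
      by (intro has_weak_pd_lincomb sobolev_1_has_weak_pd sobolev_2D(1)[OF u]
          has_weak_pd_test_function \<phi>(1))
    then have w: "has_weak_pd \<Omega> i (\<lambda>x. u x - \<phi> x) (\<lambda>x. weak_pd \<Omega> i u x - pd i \<phi> x)" by simp
    have "sobolev_norm_sq \<Omega> 1 (\<lambda>x. weak_pd \<Omega> i u x - pd i \<phi> x)
        = sobolev_norm_sq \<Omega> 1 (weak_pd \<Omega> i (\<lambda>x. u x - \<phi> x))"
      using has_weak_pd_weak_pd[OF w] weak_pd_ae_eq[OF w]
      by (intro sobolev_norm_sq_1_cong) (auto simp: has_weak_pd_def)
    also have "\<dots> \<le> (\<Sum>j\<in>UNIV. sobolev_norm_sq \<Omega> 1 (weak_pd \<Omega> j (\<lambda>x. u x - \<phi> x)))"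
      by (rule member_le_sum) (auto simp only: sobolev_norm_sq_nonneg UNIV_I finite)
    also have "\<dots> \<le> sobolev_norm_sq \<Omega> 2 (\<lambda>x. u x - \<phi> x)"
      unfolding numeral_2_eq_2 sobolev_norm_sq.simps(2)[of \<Omega> "Suc 0"] One_nat_def
      using L2_inner_self_nonneg by simp
    finally have "sqrt (sobolev_norm_sq \<Omega> 1 (\<lambda>x. weak_pd \<Omega> i u x - pd i \<phi> x)) < \<epsilon>"
      using \<phi>(2) by (meson le_less_trans real_sqrt_le_mono)
    then show ?thesis using test_function_pd[OF \<phi>(1)] by blast
  qed
  then show ?thesis
    using sobolev_2D(2)[OF u] by (simp add: sobolev_0_def del: sobolev.simps One_nat_def)
qed

end

section \<open>Piecewise polynomials on a mesh\<close>

text \<open>The points of the interior of \<open>K\<close> at which the polynomials differ form an open null set, which is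
  empty. The interior is nonempty because \<open>K\<close> is a nondegenerate triangle.\<close>

lemma polys_ae_eq_imp_eq:
  assumes "p \<in> polys m" "q \<in> polys n" "2 simplex K" "ae_eq K p q"
  shows "p = q"
proof -
  have K: "K \<in> sets lebesgue"
    using closed_simplex[OF assms(3)] by (simp add: borel_closed)
  have "interior K \<noteq> {}"
  proof -
    have "aff_dim K = 2" "convex K"
      using aff_dim_simplex[OF assms(3)] convex_simplex[OF assms(3)] by auto
    moreover from this have "K \<noteq> {}" by auto
    ultimately show ?thesis by (simp add: interior_rel_interior_gen rel_interior_eq_empty)
  qed
  define d where "d x = p x + (- 1) * q x" for x
  have d: "d \<in> polys (max m n)"
    unfolding d_def[abs_def] using assms(1,2) polys_mono
    by (intro polys_lincomb) (auto intro: max.cobounded1 max.cobounded2)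
  have "negligible {x \<in> K. \<not> p x = q x}"
    using assms(4) K by (simp add: ae_eq_def AE_lebesgue_on_iff_negligible)
  then have neg: "negligible {x \<in> interior K. d x \<noteq> 0}"
    by (rule negligible_subset) (use interior_subset in \<open>auto simp: d_def\<close>)
  have "open {x \<in> interior K. d x \<noteq> 0}"
  proof -
    have "open (interior K \<inter> d -` (- {0}))"
      using polys_continuous_on[OF d] by (intro continuous_open_preimage) auto
    also have "interior K \<inter> d -` (- {0}) = {x \<in> interior K. d x \<noteq> 0}" by auto
    finally show ?thesis .
  qed
  with neg have "{x \<in> interior K. d x \<noteq> 0} = {}"
    using open_not_negligible by blast
  then have "d = (\<lambda>x. 0)"
    using \<open>interior K \<noteq> {}\<close> polys_zero_on_open[OF d open_interior] by blast
  then have "p x + (- 1) * q x = 0" for x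
    unfolding d_def[abs_def] by meson
  then show ?thesis by (auto simp: fun_eq_iff)
qed

lemma pd_polys_same: "p \<in> polys m \<Longrightarrow> pd k p \<in> polys m"
  by (rule polys_pd[OF polys_mono[of m "Suc m"]]) auto

lemma pd_polys_lincomb:
  assumes "p \<in> polys m" "q \<in> polys m"
  shows "pd k (\<lambda>x. p x + c * q x) = (\<lambda>x. pd k p x + c * pd k q x)"
  using polys_differentiable assms by (intro ext pd_lincomb) auto

lemma pd_power_polys_lincomb:
  assumes "p \<in> polys m" "q \<in> polys m"
  shows "(pd k ^^ n) (\<lambda>x. p x + c * q x) = (\<lambda>x. (pd k ^^ n) p x + c * (pd k ^^ n) q x)
     \<and> (pd k ^^ n) p \<in> polys m \<and> (pd k ^^ n) q \<in> polys m"
  by (induction n) (use assms in \<open>auto simp: pd_polys_lincomb pd_polys_same\<close>)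

text \<open>The part of the closure outside \<open>\<Omega>\<close> is a null
  set, so that almost everywhere in \<open>\<Omega>\<close> means almost everywhere in each triangle.\<close>

locale mesh_domain = bounded_open +
  fixes \<T> :: "pt set set"
  assumes negligible_boundary: "negligible (closure \<Omega> - \<Omega>)"
    and finite_mesh: "finite \<T>"
    and simplex_mesh: "K \<in> \<T> \<Longrightarrow> 2 simplex K"
    and Union_mesh: "\<Union>\<T> = closure \<Omega>"
begin

lemma element_sets: "K \<in> \<T> \<Longrightarrow> K \<in> sets lebesgue"
  using closed_simplex[OF simplex_mesh] by (simp add: borel_closed)

text \<open>Weak derivatives can be localised only to open subsets of \<open>\<Omega>\<close>. The interior of a triangle
  need not lie in \<open>\<Omega>\<close> under the assumptions of this locale, hence the intersection.\<close>

lemma ae_eq_element_interior: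
  assumes "K \<in> \<T>"
  shows "ae_eq (interior K \<inter> \<Omega>) u v \<longleftrightarrow> ae_eq K u v"
proof -
  have K: "closed K" "convex K" "K \<subseteq> closure \<Omega>"
    using assms simplex_mesh[OF assms] closed_simplex convex_simplex Union_mesh by auto
  have m: "interior K \<inter> \<Omega> \<in> sets lebesgue"
    using open_\<Omega> by (intro sets.Int) (auto simp: borel_open)
  have "negligible (frontier K \<union> (closure \<Omega> - \<Omega>))"
    using negligible_boundary negligible_convex_frontier[OF K(2)] by (rule negligible_Un[rotated])
  moreover have "{x \<in> K. u x \<noteq> v x} \<subseteq> {x \<in> interior K \<inter> \<Omega>. u x \<noteq> v x} \<union> (frontier K \<union> (closure \<Omega> - \<Omega>))"
    using K by (auto simp: frontier_def)
  ultimately have "negligible {x \<in> interior K \<inter> \<Omega>. u x \<noteq> v x} \<Longrightarrow> negligible {x \<in> K. u x \<noteq> v x}"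
    using negligible_Un negligible_subset by blast
  moreover have "{x \<in> interior K \<inter> \<Omega>. u x \<noteq> v x} \<subseteq> {x \<in> K. u x \<noteq> v x}"
    using interior_subset by auto
  ultimately show ?thesis
    unfolding ae_eq_def AE_lebesgue_on_iff_negligible[OF m]
      AE_lebesgue_on_iff_negligible[OF element_sets[OF assms]]
    using negligible_subset by blast
qed

lemma ae_eq_iff_elements: "ae_eq \<Omega> u v \<longleftrightarrow> (\<forall>K\<in>\<T>. ae_eq K u v)"
proof
  assume eq: "ae_eq \<Omega> u v"
  show "\<forall>K\<in>\<T>. ae_eq K u v"
  proof
    fix K assume K: "K \<in> \<T>"
    have m: "interior K \<inter> \<Omega> \<in> sets lebesgue"
      using open_\<Omega> by (intro sets.Int) (auto simp: borel_open)
    have "negligible {x \<in> \<Omega>. \<not> u x = v x}"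
      using eq by (simp add: ae_eq_def AE_lebesgue_on_iff_negligible)
    then have "negligible {x \<in> interior K \<inter> \<Omega>. \<not> u x = v x}"
      by (rule negligible_subset) auto
    then have "ae_eq (interior K \<inter> \<Omega>) u v"
      by (simp only: ae_eq_def AE_lebesgue_on_iff_negligible[OF m])
    then show "ae_eq K u v" using ae_eq_element_interior[OF K] by blast
  qed
next
  assume eq: "\<forall>K\<in>\<T>. ae_eq K u v"
  have "negligible (\<Union>K\<in>\<T>. {x \<in> K. \<not> u x = v x})"
  proof (rule negligible_Union)
    show "negligible A" if "A \<in> (\<lambda>K. {x \<in> K. \<not> u x = v x}) ` \<T>" for A
      using that eq element_sets by (auto simp: ae_eq_def AE_lebesgue_on_iff_negligible)
  qed (simp add: finite_mesh)
  then have "negligible {x \<in> \<Omega>. \<not> u x = v x}"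
    by (rule negligible_subset) (use Union_mesh closure_subset in blast)
  then show "ae_eq \<Omega> u v" by (simp add: ae_eq_def AE_lebesgue_on_iff_negligible)
qed

lemma piece_eqI:
  assumes "K \<in> \<T>" "p \<in> polys m" "ae_eq K v p"
  shows "piece v K = p"
  unfolding piece_def
proof (rule the_equality)
  show "p \<in> (\<Union>m. polys m) \<and> ae_eq K v p" using assms by blast
  show "q = p" if "q \<in> (\<Union>m. polys m) \<and> ae_eq K v q" for q
    using that assms polys_ae_eq_imp_eq[OF _ _ simplex_mesh[OF assms(1)]]
      ae_eq_trans ae_eq_sym by blast
qed

lemma piece_works:
  assumes "v \<in> piecewise_poly m \<T>" "K \<in> \<T>"
  shows "piece v K \<in> polys m" "ae_eq K v (piece v K)"
proof -
  obtain p where "p \<in> polys m" "ae_eq K v p"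
    using assms unfolding piecewise_poly_def by blast
  with piece_eqI[OF assms(2) this] show "piece v K \<in> polys m" "ae_eq K v (piece v K)" by auto
qed

lemma piece_lincomb:
  assumes "u \<in> piecewise_poly m \<T>" "v \<in> piecewise_poly m \<T>" "K \<in> \<T>"
  shows "piece (\<lambda>x. u x + c * v x) K = (\<lambda>x. piece u K x + c * piece v K x)"
    "(\<lambda>x. u x + c * v x) \<in> piecewise_poly m \<T>"
proof -
  have *: "(\<lambda>x. piece u K x + c * piece v K x) \<in> polys m"
    "ae_eq K (\<lambda>x. u x + c * v x) (\<lambda>x. piece u K x + c * piece v K x)" if "K \<in> \<T>" for K
    using piece_works[OF assms(1) that] piece_works[OF assms(2) that]
    by (auto simp: ae_eq_def intro: polys_lincomb)
  show "piece (\<lambda>x. u x + c * v x) K = (\<lambda>x. piece u K x + c * piece v K x)"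
    by (rule piece_eqI[OF assms(3) *[OF assms(3)]])
  show "(\<lambda>x. u x + c * v x) \<in> piecewise_poly m \<T>"
    using * unfolding piecewise_poly_def by blast
qed

lemma piece_cong:
  assumes "ae_eq \<Omega> u v" "K \<in> \<T>"
  shows "piece u K = piece v K"
proof -
  have "ae_eq K u v" using assms ae_eq_iff_elements by blast
  then have "ae_eq K u p = ae_eq K v p" for p
    using ae_eq_trans ae_eq_sym by blast
  then show ?thesis by (simp add: piece_def)
qed

lemma piecewise_poly_cong:
  "ae_eq \<Omega> u v \<Longrightarrow> u \<in> piecewise_poly m \<T> \<Longrightarrow> v \<in> piecewise_poly m \<T>"
  unfolding piecewise_poly_def ae_eq_iff_elements using ae_eq_trans ae_eq_sym by blast

lemma C_at_cong: "ae_eq \<Omega> u v \<Longrightarrow> C_at r \<T> u a = C_at r \<T> v a"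
  unfolding C_at_def using piece_cong by (simp cong: ball_cong)

lemma C_at_lincomb:
  assumes "u \<in> piecewise_poly m \<T>" "v \<in> piecewise_poly m \<T>" "C_at r \<T> u a" "C_at r \<T> v a"
  shows "C_at r \<T> (\<lambda>x. u x + c * v x) a"
proof -
  have lin: "(pd 1 ^^ i) ((pd 2 ^^ j) (piece (\<lambda>x. u x + c * v x) K)) a
      = (pd 1 ^^ i) ((pd 2 ^^ j) (piece u K)) a + c * (pd 1 ^^ i) ((pd 2 ^^ j) (piece v K)) a"
    if K: "K \<in> \<T>" for K i j
  proof -
    note p = piece_works(1)[OF assms(1) K] piece_works(1)[OF assms(2) K]
    note j = pd_power_polys_lincomb[OF p, where k = 2 and n = j]
    show ?thesis
      unfolding piece_lincomb(1)[OF assms(1,2) K] conjunct1[OF j]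
        conjunct1[OF pd_power_polys_lincomb[OF conjunct1[OF conjunct2[OF j]]
            conjunct2[OF conjunct2[OF j]], where k = 1 and n = i]] ..
  qed
  have C:
    "(pd 1 ^^ i) ((pd 2 ^^ j) (piece u K)) a = (pd 1 ^^ i) ((pd 2 ^^ j) (piece u L)) a"
    "(pd 1 ^^ i) ((pd 2 ^^ j) (piece v K)) a = (pd 1 ^^ i) ((pd 2 ^^ j) (piece v L)) a"
    if "K \<in> \<T>" "L \<in> \<T>" "a \<in> verts K \<and> a \<in> verts L" "i + j \<le> r" for K L i j
    using assms(3,4) that unfolding C_at_def by blast+
  show ?thesis
    unfolding C_at_def
  proof (intro ballI impI allI)
    fix K L i j assume KL: "K \<in> \<T>" "L \<in> \<T>" "a \<in> verts K \<and> a \<in> verts L" and ij: "i + j \<le> r"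
    show "(pd 1 ^^ i) ((pd 2 ^^ j) (piece (\<lambda>x. u x + c * v x) K)) a
        = (pd 1 ^^ i) ((pd 2 ^^ j) (piece (\<lambda>x. u x + c * v x) L)) a"
      unfolding lin[OF KL(1)] lin[OF KL(2)] C[OF KL ij] ..
  qed
qed

lemma weak_pd_piece:
  assumes u: "u \<in> sobolev \<Omega> 1" "u \<in> piecewise_poly (Suc m) \<T>" and K: "K \<in> \<T>"
  shows "ae_eq K (weak_pd \<Omega> i u) (pd i (piece u K))" "pd i (piece u K) \<in> polys m"
proof -
  have p: "piece u K \<in> polys (Suc m)" and eq: "ae_eq K u (piece u K)"
    using piece_works[OF u(2) K] by auto
  show dp: "pd i (piece u K) \<in> polys m" by (rule polys_pd[OF p])
  have "ae_eq (interior K \<inter> \<Omega>) (weak_pd \<Omega> i u) (pd i (piece u K))"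
    using eq polys_differentiable[OF p] polys_continuous_on[OF dp] open_\<Omega> u(1)
    by (intro weak_pd_on_open) (auto simp: ae_eq_element_interior[OF K])
  then show "ae_eq K (weak_pd \<Omega> i u) (pd i (piece u K))"
    by (simp add: ae_eq_element_interior[OF K])
qed

lemma weak_pd_piecewise_poly:
  assumes u: "u \<in> sobolev \<Omega> 1" "u \<in> piecewise_poly (Suc m) \<T>"
  shows "weak_pd \<Omega> i u \<in> piecewise_poly m \<T>"
    "K \<in> \<T> \<Longrightarrow> piece (weak_pd \<Omega> i u) K = pd i (piece u K)"
proof -
  show "weak_pd \<Omega> i u \<in> piecewise_poly m \<T>"
    unfolding piecewise_poly_def using weak_pd_piece[OF u] by blast
  show "piece (weak_pd \<Omega> i u) K = pd i (piece u K)" if "K \<in> \<T>"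
    by (rule piece_eqI[OF that weak_pd_piece(2,1)[OF u that]])
qed

text \<open>On each element, a derivative of order at most \<open>1\<close> of \<open>weak_pd \<Omega> k u\<close> is a derivative of order at
  most \<open>2\<close> of \<open>u\<close>. Bringing it into the fixed order of differentiation that the definition of
  \<open>C_at\<close> prescribes requires the symmetry of second derivatives.\<close>

lemma C_at_weak_pd:
  assumes u: "u \<in> sobolev \<Omega> 1" "u \<in> piecewise_poly (Suc m) \<T>" and C: "C_at 2 \<T> u a"
  shows "C_at 1 \<T> (weak_pd \<Omega> k u) a"
proof -
  have shift: "\<exists>i' j'. i' + j' \<le> 2 \<and> (\<forall>p\<in>polys (Suc m).
      (pd 1 ^^ i) ((pd 2 ^^ j) (pd k p)) = (pd 1 ^^ i') ((pd 2 ^^ j') p))"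
    if ij: "i + j \<le> 1" for i j
  proof (cases "k = 1")
    case True
    have comm: "(pd 2 ^^ j) (pd 1 p) = pd 1 ((pd 2 ^^ j) p)" if "p \<in> polys (Suc m)" for p
    proof -
      have "j = 0 \<or> j = 1" using ij by linarith
      then show ?thesis using pd_polys_commute[OF that] by fastforce
    qed
    have "\<forall>p\<in>polys (Suc m). (pd 1 ^^ i) ((pd 2 ^^ j) (pd k p)) = (pd 1 ^^ Suc i) ((pd 2 ^^ j) p)"
      by (simp add: True comm funpow_swap1)
    with ij show ?thesis by (intro exI[of _ "Suc i"] exI[of _ j]) simp
  next
    case False
    then have k: "k = 2" by (metis exhaust_2)
    have "(pd 1 ^^ i) ((pd 2 ^^ j) (pd k p)) = (pd 1 ^^ i) ((pd 2 ^^ Suc j) p)" for p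
      by (simp add: k funpow_swap1)
    with ij show ?thesis by (intro exI[of _ i] exI[of _ "Suc j"]) simp
  qed
  show ?thesis
    unfolding C_at_def
  proof (intro ballI impI allI)
    fix K L i j assume KL: "K \<in> \<T>" "L \<in> \<T>" "a \<in> verts K \<and> a \<in> verts L" and ij: "i + j \<le> (1::nat)"
    obtain i' j' where s: "i' + j' \<le> 2" "\<And>p. p \<in> polys (Suc m) \<Longrightarrow>
        (pd 1 ^^ i) ((pd 2 ^^ j) (pd k p)) = (pd 1 ^^ i') ((pd 2 ^^ j') p)"
      using shift[OF ij] by blast
    show "(pd 1 ^^ i) ((pd 2 ^^ j) (piece (weak_pd \<Omega> k u) K)) a
        = (pd 1 ^^ i) ((pd 2 ^^ j) (piece (weak_pd \<Omega> k u) L)) a"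
      unfolding weak_pd_piecewise_poly(2)[OF u KL(1)] weak_pd_piecewise_poly(2)[OF u KL(2)]
        s(2)[OF piece_works(1)[OF u(2) KL(1)]] s(2)[OF piece_works(1)[OF u(2) KL(2)]]
      using C KL s(1) unfolding C_at_def by blast
  qed
qed

end

section \<open>Projection with respect to a degenerate inner product\<close>

text \<open>The degenerate case of the Cauchy-Schwarz inequality: if \<open>B u w\<close> were nonzero, then \<open>B\<close> would
  be affine and nonconstant, hence somewhere negative, along the line through \<open>u\<close> in direction
  \<open>w\<close>.\<close>

lemma psd_form_null:
  fixes S :: "('x \<Rightarrow> 'b::real_vector) set" and B :: "('x \<Rightarrow> 'b) \<Rightarrow> ('x \<Rightarrow> 'b) \<Rightarrow> real"
  assumes lin: "\<And>u v c. \<lbrakk>u \<in> S; v \<in> S\<rbrakk> \<Longrightarrow> (\<lambda>x. u x + c *\<^sub>R v x) \<in> S"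
    and sym: "\<And>u v. B u v = B v u"
    and B_lin: "\<And>u v w c. \<lbrakk>u \<in> S; v \<in> S; w \<in> S\<rbrakk> \<Longrightarrow> B (\<lambda>x. u x + c *\<^sub>R v x) w = B u w + c * B v w"
    and psd: "\<And>u. u \<in> S \<Longrightarrow> 0 \<le> B u u"
    and uw: "u \<in> S" "w \<in> S" and null: "B w w = 0"
  shows "B u w = 0"
proof (rule ccontr)
  assume nz: "B u w \<noteq> 0"
  define t where "t = - (B u u + 1) / (2 * B u w)"
  let ?z = "\<lambda>x. u x + t *\<^sub>R w x"
  have z: "?z \<in> S" using lin uw by blast
  have "B ?z ?z = B u ?z + t * B w ?z" by (rule B_lin[OF uw z])
  also have "B u ?z = B u u + t * B u w"
    using B_lin[OF uw uw(1), of t] sym by metis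
  also have "B w ?z = B u w"
    using B_lin[OF uw uw(2), of t] sym null by (metis add.right_neutral mult_zero_right)
  also have "B u u + t * B u w + t * B u w = - 1"
    using nz by (simp add: t_def field_simps)
  finally show False using psd[OF z] by simp
qed

text \<open>In the application, functions that agree almost everywhere are not identified, so \<open>B\<close> is only semidefinite on \<open>S\<close> and
  \<open>W\<close> need not be finite-dimensional as a space of functions. It suffices that finitely many linear
  functionals detect the elements of \<open>W\<close> up to the kernel of \<open>B\<close>. The induction removes one functional
  at a time by passing to its kernel, which has codimension at most one; a missing direction \<open>w1\<close>,
  made orthogonal to the kernel, is added back as in the Gram-Schmidt process.\<close>

lemma projection_exists:
  fixes S W :: "('x \<Rightarrow> 'b::real_vector) set" and B :: "('x \<Rightarrow> 'b) \<Rightarrow> ('x \<Rightarrow> 'b) \<Rightarrow> real"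
    and L :: "(('x \<Rightarrow> 'b) \<Rightarrow> real) set"
  assumes S_lin: "\<And>u v c. \<lbrakk>u \<in> S; v \<in> S\<rbrakk> \<Longrightarrow> (\<lambda>x. u x + c *\<^sub>R v x) \<in> S"
    and sym: "\<And>u v. B u v = B v u"
    and B_lin: "\<And>u v w c. \<lbrakk>u \<in> S; v \<in> S; w \<in> S\<rbrakk> \<Longrightarrow> B (\<lambda>x. u x + c *\<^sub>R v x) w = B u w + c * B v w"
    and psd: "\<And>u. u \<in> S \<Longrightarrow> 0 \<le> B u u"
    and L: "finite L"
    and W: "W \<subseteq> S" "W \<noteq> {}" "\<And>u v c. \<lbrakk>u \<in> W; v \<in> W\<rbrakk> \<Longrightarrow> (\<lambda>x. u x + c *\<^sub>R v x) \<in> W"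
    and L_lin: "\<And>l u v c. \<lbrakk>l \<in> L; u \<in> W; v \<in> W\<rbrakk> \<Longrightarrow> l (\<lambda>x. u x + c *\<^sub>R v x) = l u + c * l v"
    and L_null: "\<And>u w. \<lbrakk>u \<in> S; w \<in> W; \<And>l. l \<in> L \<Longrightarrow> l w = 0\<rbrakk> \<Longrightarrow> B u w = 0"
    and u: "u \<in> S"
  shows "\<exists>p\<in>W. \<forall>w\<in>W. B p w = B u w"
  using L W L_lin L_null u
proof (induction L arbitrary: W u rule: finite_induct)
  case empty
  then obtain p where "p \<in> W" by blast
  with empty show ?case by (intro bexI[of _ p]) (auto simp: subset_iff)
next
  case (insert l L)
  note W = insert.prems(1-3) and l_lin = insert.prems(4) and null = insert.prems(5)
  have WS: "w \<in> S" if "w \<in> W" for w using that W(1) by blast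
  define W' where "W' = {w \<in> W. l w = 0}"
  have W': "W' \<subseteq> S" "W' \<noteq> {}" "\<And>u v c. \<lbrakk>u \<in> W'; v \<in> W'\<rbrakk> \<Longrightarrow> (\<lambda>x. u x + c *\<^sub>R v x) \<in> W'"
  proof -
    show "W' \<subseteq> S" using W(1) by (auto simp: W'_def)
    obtain w where w: "w \<in> W" using W(2) by blast
    then have "(\<lambda>x. w x + (- 1) *\<^sub>R w x) \<in> W'"
      unfolding W'_def using W(3)[OF w w, of "- 1"] l_lin[OF insertI1 w w, of "- 1"] by simp
    then show "W' \<noteq> {}" by blast
    show "(\<lambda>x. u x + c *\<^sub>R v x) \<in> W'" if "u \<in> W'" "v \<in> W'" for u v c
      using that W(3) l_lin[OF insertI1] by (simp add: W'_def)
  qed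
  have IH: "\<exists>p\<in>W'. \<forall>w\<in>W'. B p w = B z w" if "z \<in> S" for z
  proof (rule insert.IH[OF W' _ _ that])
    show "l' (\<lambda>x. u x + c *\<^sub>R v x) = l' u + c * l' v" if "l' \<in> L" "u \<in> W'" "v \<in> W'" for l' u v c
      using that l_lin[of l'] by (simp add: W'_def)
    show "B u w = 0" if "u \<in> S" "w \<in> W'" "\<And>l. l \<in> L \<Longrightarrow> l w = 0" for u w
      using that null[of u w] by (auto simp: W'_def)
  qed
  obtain p' where p': "p' \<in> W'" "\<And>w. w \<in> W' \<Longrightarrow> B p' w = B u w"
    using IH[OF insert.prems(6)] by blast
  show ?case
  proof (cases "W' = W")
    case True
    then show ?thesis using p' by blast
  next
    case False
    then obtain w0 where w0: "w0 \<in> W" "l w0 \<noteq> 0" by (auto simp: W'_def)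
    obtain q where q: "q \<in> W'" "\<And>w. w \<in> W' \<Longrightarrow> B q w = B w0 w"
      using IH[OF WS[OF w0(1)]] by blast
    have W'W: "w \<in> W" if "w \<in> W'" for w using that by (simp add: W'_def)
    define w1 where "w1 = (\<lambda>x. w0 x + (- 1) *\<^sub>R q x)"
    have w1: "w1 \<in> W" "l w1 = l w0" "\<And>w. w \<in> W' \<Longrightarrow> B w1 w = 0"
    proof -
      show "w1 \<in> W" unfolding w1_def by (rule W(3)[OF w0(1) W'W[OF q(1)]])
      show "l w1 = l w0"
        unfolding w1_def using l_lin[OF insertI1 w0(1) W'W[OF q(1)], of "- 1"] q(1)
        by (simp add: W'_def)
      show "B w1 w = 0" if "w \<in> W'" for w
        unfolding w1_def using B_lin[OF WS WS WS, OF w0(1) W'W[OF q(1)] W'W[OF that], of "- 1"] q(2)[OF that]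
        by simp
    qed
    \<comment> \<open>If \<open>B w1 w1 = 0\<close>, this default value is correct as well, because \<open>B u w1 = 0\<close> then.\<close>
    define c where "c = B u w1 / B w1 w1"
    have "B u w1 = 0" if "B w1 w1 = 0"
      by (rule psd_form_null[where S = S and B = B,
            OF S_lin sym B_lin psd insert.prems(6) WS[OF w1(1)] that])
    then have c: "c * B w1 w1 = B u w1" by (auto simp: c_def)
    define p where "p = (\<lambda>x. p' x + c *\<^sub>R w1 x)"
    have p: "p \<in> W" unfolding p_def by (rule W(3)[OF W'W[OF p'(1)] w1(1)])
    have Bp: "B p w = B p' w + c * B w1 w" if "w \<in> W" for w
      unfolding p_def by (intro B_lin WS W'W p'(1) w1(1) that)
    have "B p w = B u w" if w: "w \<in> W" for w
    proof -
      define t where "t = l w / l w1"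
      define w' where "w' = (\<lambda>x. w x + (- t) *\<^sub>R w1 x)"
      have w': "w' \<in> W'"
        using W(3)[OF w w1(1), of "- t"] l_lin[OF insertI1 w w1(1), of "- t"] w1(2) w0(2)
        by (simp add: W'_def w'_def t_def)
      have split: "B z w = B z w' + t * B z w1" if "z \<in> S" for z
        using B_lin[OF WS[OF w] WS[OF w1(1)] that, of "- t"] by (simp add: w'_def sym[of z])
      have "B p w' = B u w'"
        using Bp[OF W'W[OF w']] p'(2)[OF w'] w1(3)[OF w'] by simp
      moreover have "B p w1 = B u w1"
        using Bp[OF w1(1)] c w1(3)[OF p'(1)] by (simp add: sym[of p'])
      ultimately show ?thesis
        using split[OF WS[OF p]] split[OF insert.prems(6)] by simp
    qed
    with p show ?thesis by blast
  qed
qed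

section \<open>Discrete velocities, curls and divergences\<close>

context mesh_domain
begin

lemma V0D:
  assumes "u \<in> V0 cs \<Omega> \<T> k"
  shows "u \<in> sobolev \<Omega> 1" "u \<in> piecewise_poly k \<T>"
  using assms unfolding V0_def V_space_def by blast+

lemma V0_lincomb:
  assumes "u \<in> V0 cs \<Omega> \<T> k" "v \<in> V0 cs \<Omega> \<T> k"
  shows "(\<lambda>x. u x + c * v x) \<in> V0 cs \<Omega> \<T> k"
  using assms sobolev_1_lincomb[of u v c] sobolev_0_1_lincomb[of u v c]
    piece_lincomb(2)[of u k v _ c] C_at_lincomb[of u k v 1 _ c]
  unfolding V0_def V_space_def piecewise_poly_def by blast

lemma V0_vecD:
  assumes "v \<in> V0_vec cs \<Omega> \<T> k"
  shows "(\<lambda>x. v x $ i) \<in> V0 cs \<Omega> \<T> k" "(\<lambda>x. v x $ i) \<in> sobolev \<Omega> 1"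
    "weak_pd \<Omega> j (\<lambda>x. v x $ i) \<in> L2 \<Omega>"
proof -
  show v: "(\<lambda>x. v x $ i) \<in> V0 cs \<Omega> \<T> k" using assms unfolding V0_vec_def by blast
  show "(\<lambda>x. v x $ i) \<in> sobolev \<Omega> 1" by (rule V0D(1)[OF v])
  then show "weak_pd \<Omega> j (\<lambda>x. v x $ i) \<in> L2 \<Omega>" by (rule sobolev_1_L2(2))
qed

lemma V0_vec_lincomb:
  assumes "u \<in> V0_vec cs \<Omega> \<T> k" "v \<in> V0_vec cs \<Omega> \<T> k"
  shows "(\<lambda>x. u x + c *\<^sub>R v x) \<in> V0_vec cs \<Omega> \<T> k"
  using V0_lincomb[OF V0_vecD(1)[OF assms(1)] V0_vecD(1)[OF assms(2)]]
  unfolding V0_vec_def by simp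

lemma weak_pd_component_lincomb:
  assumes "u \<in> V0_vec cs \<Omega> \<T> k" "v \<in> V0_vec cs \<Omega> \<T> k"
  shows "ae_eq \<Omega> (weak_pd \<Omega> j (\<lambda>x. (u x + c *\<^sub>R v x) $ i))
     (\<lambda>x. weak_pd \<Omega> j (\<lambda>x. u x $ i) x + c * weak_pd \<Omega> j (\<lambda>x. v x $ i) x)"
  using weak_pd_lincomb[OF V0_vecD(2)[OF assms(1)] V0_vecD(2)[OF assms(2)]] by simp

lemma a_form_commute: "a_form \<Omega> u v = a_form \<Omega> v u"
  unfolding a_form_def by (simp add: L2_inner_commute)

lemma a_form_lincomb:
  assumes "u \<in> V0_vec cs \<Omega> \<T> k" "v \<in> V0_vec cs \<Omega> \<T> k" "w \<in> V0_vec cs \<Omega> \<T> k"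
  shows "a_form \<Omega> (\<lambda>x. u x + c *\<^sub>R v x) w = a_form \<Omega> u w + c * a_form \<Omega> v w"
proof -
  have "L2_inner \<Omega> (weak_pd \<Omega> j (\<lambda>x. (u x + c *\<^sub>R v x) $ i)) (weak_pd \<Omega> j (\<lambda>x. w x $ i))
      = L2_inner \<Omega> (weak_pd \<Omega> j (\<lambda>x. u x $ i)) (weak_pd \<Omega> j (\<lambda>x. w x $ i))
        + c * L2_inner \<Omega> (weak_pd \<Omega> j (\<lambda>x. v x $ i)) (weak_pd \<Omega> j (\<lambda>x. w x $ i))" for i j
  proof -
    note L2 = V0_vecD(3)[OF assms(1)] V0_vecD(3)[OF assms(2)] V0_vecD(3)[OF assms(3)]
    show ?thesis
      unfolding L2_inner_lincomb_left[OF L2, symmetric]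
      by (rule L2_inner_ae_eq[OF \<Omega>_sets L2_lincomb[OF L2(1,2)] L2(3)
            ae_eq_sym[OF weak_pd_component_lincomb[OF assms(1,2)]] ae_eq_refl])
  qed
  then show ?thesis
    unfolding a_form_def by (simp add: sum.distrib sum_distrib_left)
qed

lemma a_form_nonneg: "0 \<le> a_form \<Omega> u u"
  unfolding a_form_def by (intro sum_nonneg L2_inner_self_nonneg)

lemma H1_seminorm_eq: "H1_seminorm \<Omega> u = sqrt (a_form \<Omega> u u)"
  by (simp add: H1_seminorm_def a_form_def L2_norm_def L2_inner_self_nonneg)

lemma H1_seminorm_le_norm: "H1_seminorm \<Omega> u \<le> H1_norm \<Omega> u"
proof -
  have "a_form \<Omega> u u \<le> (\<Sum>i\<in>UNIV. sobolev_norm_sq \<Omega> 1 (\<lambda>x. u x $ i))"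
    unfolding a_form_def sobolev_norm_sq_1 using L2_inner_self_nonneg by (intro sum_mono) simp
  then show ?thesis by (simp add: H1_seminorm_eq H1_norm_def)
qed

lemma divergence_lincomb:
  assumes "u \<in> V0_vec cs \<Omega> \<T> k" "v \<in> V0_vec cs \<Omega> \<T> k"
  shows "ae_eq \<Omega> (divergence \<Omega> (\<lambda>x. u x + c *\<^sub>R v x))
     (\<lambda>x. divergence \<Omega> u x + c * divergence \<Omega> v x)"
proof -
  have "AE x in lebesgue_on \<Omega>. \<forall>i. weak_pd \<Omega> i (\<lambda>x. (u x + c *\<^sub>R v x) $ i) x
      = weak_pd \<Omega> i (\<lambda>x. u x $ i) x + c * weak_pd \<Omega> i (\<lambda>x. v x $ i) x"
    using weak_pd_component_lincomb[OF assms] unfolding AE_all_countable ae_eq_def by blast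
  then show ?thesis
    unfolding ae_eq_def divergence_def
    by eventually_elim (simp add: sum.distrib sum_distrib_left)
qed

lemma weak_pd_zero: "ae_eq \<Omega> u (\<lambda>x. 0) \<Longrightarrow> ae_eq \<Omega> (weak_pd \<Omega> i u) (\<lambda>x. 0)"
proof -
  assume u: "ae_eq \<Omega> u (\<lambda>x. 0)"
  have "has_weak_pd \<Omega> i (\<lambda>x. 0) (pd i (\<lambda>x. 0))"
    by (rule has_weak_pd_classical[OF open_\<Omega> bounded_\<Omega>]) (auto simp: pd_zero)
  from weak_pd_ae_eq[OF this] show ?thesis by (simp add: weak_pd_cong[OF u] pd_zero)
qed

lemma L2_inner_zero: "ae_eq S g (\<lambda>x. 0) \<Longrightarrow> L2_inner S f g = 0"
  unfolding L2_inner_def ae_eq_def by (rule integral_eq_zero_AE) auto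

lemma weak_pd_Sigma0_V0:
  assumes "\<psi> \<in> Sigma0 cs \<Omega> \<T> k"
  shows "weak_pd \<Omega> i \<psi> \<in> V0 cs \<Omega> \<T> k"
proof -
  have \<psi>: "\<psi> \<in> sobolev_0 \<Omega> 2" "\<psi> \<in> piecewise_poly (Suc k) \<T>"
    "\<And>a. a \<in> noncorner_vertices cs \<T> \<Longrightarrow> C_at 2 \<T> \<psi> a"
    using assms unfolding Sigma0_def by auto
  then have "\<psi> \<in> sobolev \<Omega> 2" unfolding sobolev_0_def by blast
  note H = sobolev_2D[OF this]
  show ?thesis
    unfolding V0_def V_space_def
    using H(2) sobolev_0_2_weak_pd[OF \<psi>(1)] weak_pd_piecewise_poly(1)[OF H(1) \<psi>(2)]
      C_at_weak_pd[OF H(1) \<psi>(2) \<psi>(3)] by blast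
qed

lemma curl_component:
  "(\<lambda>x. curl \<Omega> \<psi> x $ 1) = weak_pd \<Omega> 2 \<psi>"
  \<comment> \<open>The negation is written as a linear combination, since the spaces are shown to be closed under these.\<close>
  "(\<lambda>x. curl \<Omega> \<psi> x $ 2) = (\<lambda>x. weak_pd \<Omega> 1 \<psi> x + (- 2) * weak_pd \<Omega> 1 \<psi> x)"
  by (auto simp: curl_def)

lemma curl_Sigma0_V0_vec:
  assumes "\<psi> \<in> Sigma0 cs \<Omega> \<T> k"
  shows "curl \<Omega> \<psi> \<in> V0_vec cs \<Omega> \<T> k"
proof -
  note w = weak_pd_Sigma0_V0[OF assms]
  have "(\<lambda>x. curl \<Omega> \<psi> x $ i) \<in> V0 cs \<Omega> \<T> k" for i
    using exhaust_2[of i] curl_component[of \<psi>] w[of 2] V0_lincomb[OF w w, of 1 "- 2" 1] by metis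
  then show ?thesis unfolding V0_vec_def by blast
qed

text \<open>Both mixed weak derivatives are the mixed classical derivatives of the polynomial pieces, where
  their order does not matter.\<close>

lemma divergence_curl:
  assumes "\<psi> \<in> Sigma0 cs \<Omega> \<T> (Suc k)"
  shows "ae_eq \<Omega> (divergence \<Omega> (curl \<Omega> \<psi>)) (\<lambda>x. 0)"
proof -
  have \<psi>: "\<psi> \<in> sobolev_0 \<Omega> 2" "\<psi> \<in> piecewise_poly (Suc (Suc k)) \<T>"
    using assms unfolding Sigma0_def by auto
  then have "\<psi> \<in> sobolev \<Omega> 2" unfolding sobolev_0_def by blast
  note H = sobolev_2D[OF this]
  have second: "ae_eq \<Omega> (weak_pd \<Omega> 1 (weak_pd \<Omega> 2 \<psi>)) (weak_pd \<Omega> 2 (weak_pd \<Omega> 1 \<psi>))"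
    unfolding ae_eq_iff_elements
  proof
    fix K assume K: "K \<in> \<T>"
    have "ae_eq K (weak_pd \<Omega> i (weak_pd \<Omega> j \<psi>)) (pd i (pd j (piece \<psi> K)))" for i j
      using weak_pd_piece(1)[OF H(2) weak_pd_piecewise_poly(1)[OF H(1) \<psi>(2)] K]
      unfolding weak_pd_piecewise_poly(2)[OF H(1) \<psi>(2) K] .
    then show "ae_eq K (weak_pd \<Omega> 1 (weak_pd \<Omega> 2 \<psi>)) (weak_pd \<Omega> 2 (weak_pd \<Omega> 1 \<psi>))"
      using pd_polys_commute[OF piece_works(1)[OF \<psi>(2) K]] ae_eq_trans ae_eq_sym by metis
  qed
  have neg: "ae_eq \<Omega> (weak_pd \<Omega> 2 (\<lambda>x. weak_pd \<Omega> 1 \<psi> x + (- 2) * weak_pd \<Omega> 1 \<psi> x))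
      (\<lambda>x. weak_pd \<Omega> 2 (weak_pd \<Omega> 1 \<psi>) x + (- 2) * weak_pd \<Omega> 2 (weak_pd \<Omega> 1 \<psi>) x)"
    by (rule weak_pd_lincomb[OF H(2) H(2)])
  have div: "divergence \<Omega> (curl \<Omega> \<psi>) = (\<lambda>x. weak_pd \<Omega> 1 (weak_pd \<Omega> 2 \<psi>) x
      + weak_pd \<Omega> 2 (\<lambda>x. weak_pd \<Omega> 1 \<psi> x + (- 2) * weak_pd \<Omega> 1 \<psi> x) x)"
    unfolding divergence_def sum_2 curl_component ..
  from second neg show ?thesis
    unfolding div ae_eq_def by eventually_elim simp
qed

lemma Q0_L2: "q \<in> Q0 cs \<Omega> \<T> k \<Longrightarrow> q \<in> L2 \<Omega>"
  by (simp add: Q0_def Q_space_def)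

lemma Q_E_L2: "q \<in> Q_E cs \<Omega> \<T> k \<Longrightarrow> q \<in> L2 \<Omega>"
  using Q0_L2 by (auto simp: Q_E_def)

lemma Q_E_cong:
  assumes "q \<in> Q_E cs \<Omega> \<T> k" "ae_eq \<Omega> q q'"
  shows "q' \<in> Q_E cs \<Omega> \<T> k"
proof -
  have L2: "q \<in> L2 \<Omega>" "q' \<in> L2 \<Omega>"
    using Q_E_L2[OF assms(1)] L2_ae_eq[OF \<Omega>_sets _ assms(2)] by auto
  have "(LINT x|lebesgue_on \<Omega>. q' x) = (LINT x|lebesgue_on \<Omega>. q x)"
    using L2 assms(2) by (intro integral_cong_AE) (auto simp: L2_def ae_eq_def)
  moreover have "L2_inner \<Omega> q' r = L2_inner \<Omega> q r" if "r \<in> Q_I cs \<Omega> \<T> k" for r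
    using that Q0_L2 by (intro L2_inner_ae_eq[OF \<Omega>_sets L2(1) _ assms(2) ae_eq_refl]) (auto simp: Q_I_def)
  ultimately show ?thesis
    using assms(1) L2 piecewise_poly_cong[OF assms(2)] C_at_cong[OF assms(2)]
    by (simp add: Q_E_def Q0_def Q_space_def L2_0_def)
qed

text \<open>The lift is made orthogonal to this whole space rather than to the curls of \<open>Sigma_I\<close> alone. It
  contains those curls, it is visibly closed under linear combinations, and subtracting its elements
  preserves the divergence.\<close>

definition solenoidal :: "pt list \<Rightarrow> nat \<Rightarrow> vector_fun set" where
  "solenoidal cs k = {z \<in> V0_vec cs \<Omega> \<T> k. ae_eq \<Omega> (divergence \<Omega> z) (\<lambda>x. 0)}"

lemma solenoidal_lincomb:
  assumes "u \<in> solenoidal cs k" "v \<in> solenoidal cs k"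
  shows "(\<lambda>x. u x + c *\<^sub>R v x) \<in> solenoidal cs k"
proof -
  have uv: "u \<in> V0_vec cs \<Omega> \<T> k" "v \<in> V0_vec cs \<Omega> \<T> k"
    and zero: "ae_eq \<Omega> (divergence \<Omega> u) (\<lambda>x. 0)" "ae_eq \<Omega> (divergence \<Omega> v) (\<lambda>x. 0)"
    using assms by (auto simp: solenoidal_def)
  have "ae_eq \<Omega> (divergence \<Omega> (\<lambda>x. u x + c *\<^sub>R v x)) (\<lambda>x. 0)"
    using divergence_lincomb[OF uv, of c] zero unfolding ae_eq_def by eventually_elim simp
  with V0_vec_lincomb[OF uv] show ?thesis by (simp add: solenoidal_def)
qed

text \<open>The functionals are the values of the polynomial pieces at grid points. If all of them vanish on
  \<open>w\<close>, then \<open>w\<close> vanishes almost everywhere and so do its weak derivatives.\<close>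

lemma solenoidal_projection:
  assumes u: "u \<in> V0_vec cs \<Omega> \<T> k"
  shows "\<exists>p\<in>solenoidal cs k. \<forall>z\<in>solenoidal cs k. a_form \<Omega> p z = a_form \<Omega> u z"
proof -
  define node where "node = (\<lambda>(K, a, b, i) (w :: vector_fun). piece (\<lambda>x. w x $ i) K (vector [real a, real b]))"
  define nodes where "nodes = node ` (\<T> \<times> {..k} \<times> {..k} \<times> UNIV)"
  show ?thesis
  proof (rule projection_exists[where S = "V0_vec cs \<Omega> \<T> k" and L = nodes])
    show "finite nodes" by (simp add: nodes_def finite_mesh)
    show "solenoidal cs k \<subseteq> V0_vec cs \<Omega> \<T> k" by (auto simp: solenoidal_def)
    have "ae_eq \<Omega> (divergence \<Omega> (\<lambda>x. u x + (- 1) *\<^sub>R u x)) (\<lambda>x. 0)"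
      using divergence_lincomb[OF u u, of "- 1"] unfolding ae_eq_def by eventually_elim simp
    then have "(\<lambda>x. u x + (- 1) *\<^sub>R u x) \<in> solenoidal cs k"
      using V0_vec_lincomb[OF u u, of "- 1"] unfolding solenoidal_def by blast
    then show "solenoidal cs k \<noteq> {}" by blast
    fix l v w c assume l: "l \<in> nodes" and "v \<in> solenoidal cs k" "w \<in> solenoidal cs k"
    then have vw: "v \<in> V0_vec cs \<Omega> \<T> k" "w \<in> V0_vec cs \<Omega> \<T> k" by (auto simp: solenoidal_def)
    obtain K a b i where "K \<in> \<T>" and l: "l = node (K, a, b, i)" using l by (auto simp: nodes_def)
    then show "l (\<lambda>x. v x + c *\<^sub>R w x) = l v + c * l w"
      using piece_lincomb(1)[OF V0D(2)[OF V0_vecD(1)[OF vw(1)]] V0D(2)[OF V0_vecD(1)[OF vw(2)]]]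
      by (simp add: node_def)
  next
    fix v w assume w: "w \<in> solenoidal cs k" and zero: "\<And>l. l \<in> nodes \<Longrightarrow> l w = 0"
    have w': "w \<in> V0_vec cs \<Omega> \<T> k" using w by (simp add: solenoidal_def)
    have "ae_eq \<Omega> (\<lambda>x. w x $ i) (\<lambda>x. 0)" for i
      unfolding ae_eq_iff_elements
    proof
      fix K assume K: "K \<in> \<T>"
      note p = piece_works[OF V0D(2)[OF V0_vecD(1)[OF w']] K, of i]
      have "piece (\<lambda>x. w x $ i) K = (\<lambda>x. 0)"
      proof (rule polys_zero_on_grid[OF p(1)])
        fix a b assume "a \<le> k" "b \<le> k"
        then have "node (K, a, b, i) \<in> nodes" using K by (auto simp: nodes_def)
        from zero[OF this] show "piece (\<lambda>x. w x $ i) K (vector [real a, real b]) = 0"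
          by (simp add: node_def)
      qed
      with p(2) show "ae_eq K (\<lambda>x. w x $ i) (\<lambda>x. 0)" by simp
    qed
    then show "a_form \<Omega> v w = 0"
      unfolding a_form_def by (simp add: L2_inner_zero weak_pd_zero)
  qed (use u in \<open>auto intro: V0_vec_lincomb a_form_commute a_form_lincomb a_form_nonneg solenoidal_lincomb\<close>)
qed

text \<open>Subtracting from \<open>w\<close> its projection \<open>p\<close> onto the solenoidal fields leaves the divergence unchanged,
  enforces the orthogonality in the definition of \<open>V_E\<close>, and by Pythagoras cannot increase the
  seminorm.\<close>

lemma divergence_lift_V_E:
  assumes k: "k > 0" and q: "q \<in> Q_E cs \<Omega> \<T> k"
    and w: "w \<in> V0_vec cs \<Omega> \<T> k" "ae_eq \<Omega> (divergence \<Omega> w) q"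
  obtains v where "v \<in> V_E cs \<Omega> \<T> k" "ae_eq \<Omega> (divergence \<Omega> v) q"
    "H1_seminorm \<Omega> v \<le> H1_seminorm \<Omega> w"
proof -
  obtain p where p: "p \<in> solenoidal cs k"
    and proj: "\<And>z. z \<in> solenoidal cs k \<Longrightarrow> a_form \<Omega> p z = a_form \<Omega> w z"
    using solenoidal_projection[OF w(1)] by blast
  have pV: "p \<in> V0_vec cs \<Omega> \<T> k" and p0: "ae_eq \<Omega> (divergence \<Omega> p) (\<lambda>x. 0)"
    using p by (auto simp: solenoidal_def)
  define v where "v = (\<lambda>x. w x + (- 1) *\<^sub>R p x)"
  have vV: "v \<in> V0_vec cs \<Omega> \<T> k" unfolding v_def by (rule V0_vec_lincomb[OF w(1) pV])
  have a_v: "a_form \<Omega> v z = a_form \<Omega> w z - a_form \<Omega> p z" if "z \<in> V0_vec cs \<Omega> \<T> k" for z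
    unfolding v_def using a_form_lincomb[OF w(1) pV that, of "- 1"] by simp
  have div: "ae_eq \<Omega> (divergence \<Omega> v) q"
    using divergence_lincomb[OF w(1) pV, of "- 1"] w(2) p0 unfolding v_def ae_eq_def
    by eventually_elim simp
  have "a_form \<Omega> v (curl \<Omega> \<psi>) = 0" if "\<psi> \<in> Sigma_I cs \<Omega> \<T> k" for \<psi>
  proof -
    have \<psi>: "\<psi> \<in> Sigma0 cs \<Omega> \<T> k" using that by (simp add: Sigma_I_def)
    then have "curl \<Omega> \<psi> \<in> solenoidal cs k"
      using curl_Sigma0_V0_vec[OF \<psi>] divergence_curl[of \<psi> cs "k - 1"] k by (simp add: solenoidal_def)
    then show ?thesis using proj a_v curl_Sigma0_V0_vec[OF \<psi>] by simp
  qed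
  then have "v \<in> V_E cs \<Omega> \<T> k"
    using vV Q_E_cong[OF q ae_eq_sym[OF div]] by (simp add: V_E_def)
  moreover have "a_form \<Omega> v v \<le> a_form \<Omega> w w"
  proof -
    have "a_form \<Omega> v v = a_form \<Omega> w w - a_form \<Omega> p p"
      using a_v[OF vV] a_v[OF w(1)] a_v[OF pV] proj[OF p] a_form_commute by (smt (verit))
    then show ?thesis using a_form_nonneg[of p] by simp
  qed
  ultimately show ?thesis using that div by (simp add: H1_seminorm_eq)
qed

end

section \<open>Stability of the reduced pair\<close>

context mesh_domain
begin

lemma Q_E_uminus:
  assumes "q \<in> Q_E cs \<Omega> \<T> k"
  shows "(\<lambda>x. - q x) \<in> Q_E cs \<Omega> \<T> k"
proof -
  have q: "q \<in> L2 \<Omega>" "q \<in> piecewise_poly (k - 1) \<T>"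
    "\<And>a. a \<in> noncorner_vertices cs \<T> \<Longrightarrow> C_at 0 \<T> q a" "(LINT x|lebesgue_on \<Omega>. q x) = 0"
    "\<And>r. r \<in> Q_I cs \<Omega> \<T> k \<Longrightarrow> L2_inner \<Omega> q r = 0"
    using assms by (auto simp: Q_E_def Q0_def Q_space_def L2_0_def)
  have neg: "(\<lambda>x. q x + (- 2) * q x) = (\<lambda>x. - q x)" by auto
  show ?thesis
    using q L2_lincomb[OF q(1) q(1), of "- 2"] piece_lincomb(2)[OF q(2) q(2), of _ "- 2"]
      C_at_lincomb[OF q(2,2) q(3) q(3), of _ "- 2"]
    unfolding neg Q_E_def Q0_def Q_space_def L2_0_def
    by (auto simp: piecewise_poly_def L2_inner_def)
qed

text \<open>A lift \<open>v\<close> of \<open>- q\<close> is used, because \<open>b_form\<close> carries a minus sign: then \<open>b_form \<Omega> v q\<close> is the square of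
  the norm of \<open>q\<close>. The seminorm of \<open>v\<close> must be shown to be positive since a zero denominator would make
  the quotient \<open>0\<close>; if it vanished, so would the divergence.\<close>

lemma inf_sup_lower_bound:
  assumes \<beta>: "\<beta> > 0"
    and lift: "\<And>q. q \<in> Q_E cs \<Omega> \<T> k \<Longrightarrow> \<exists>v\<in>V_E cs \<Omega> \<T> k.
        ae_eq \<Omega> (divergence \<Omega> v) q \<and> H1_seminorm \<Omega> v \<le> inverse \<beta> * L2_norm \<Omega> q"
  shows "(INF q\<in>{q \<in> Q_E cs \<Omega> \<T> k. \<not> ae_eq \<Omega> q (\<lambda>x. 0)}.
        SUP v\<in>{v \<in> V_E cs \<Omega> \<T> k. \<not> (AE x in lebesgue_on \<Omega>. v x = 0)}.
          ereal (b_form \<Omega> v q / (H1_seminorm \<Omega> v * L2_norm \<Omega> q))) \<ge> ereal \<beta>"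
proof (rule INF_greatest)
  fix q assume "q \<in> {q \<in> Q_E cs \<Omega> \<T> k. \<not> ae_eq \<Omega> q (\<lambda>x. 0)}"
  then have q: "q \<in> Q_E cs \<Omega> \<T> k" and nz: "\<not> ae_eq \<Omega> q (\<lambda>x. 0)" by auto
  obtain v where v: "v \<in> V_E cs \<Omega> \<T> k" "ae_eq \<Omega> (divergence \<Omega> v) (\<lambda>x. - q x)"
    "H1_seminorm \<Omega> v \<le> inverse \<beta> * L2_norm \<Omega> (\<lambda>x. - q x)"
    using lift[OF Q_E_uminus[OF q]] by blast
  have L2: "q \<in> L2 \<Omega>" "(\<lambda>x. - q x) \<in> L2 \<Omega>"
    using Q_E_L2 q Q_E_uminus[OF q] by blast+
  have vV: "v \<in> V0_vec cs \<Omega> \<T> k" using v(1) by (simp add: V_E_def)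
  have norm_sq: "(L2_norm \<Omega> q)\<^sup>2 = L2_inner \<Omega> q q"
    by (simp add: L2_norm_def L2_inner_self_nonneg)
  have norm_pos: "0 < L2_norm \<Omega> q"
    using nz L2_inner_self_eq_0[OF L2(1)] L2_inner_self_nonneg[of \<Omega> q]
    by (auto simp: L2_norm_def less_le)
  have nz_div: "\<not> (\<forall>i. ae_eq \<Omega> (weak_pd \<Omega> i (\<lambda>x. v x $ i)) (\<lambda>x. 0))"
  proof
    assume "\<forall>i. ae_eq \<Omega> (weak_pd \<Omega> i (\<lambda>x. v x $ i)) (\<lambda>x. 0)"
    then have "AE x in lebesgue_on \<Omega>. \<forall>i. weak_pd \<Omega> i (\<lambda>x. v x $ i) x = 0"
      unfolding AE_all_countable ae_eq_def by blast
    then have "ae_eq \<Omega> q (\<lambda>x. 0)"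
      using v(2) unfolding ae_eq_def by eventually_elim (simp add: divergence_def)
    with nz show False ..
  qed
  have v_nz: "\<not> (AE x in lebesgue_on \<Omega>. v x = 0)"
  proof
    assume "AE x in lebesgue_on \<Omega>. v x = 0"
    then have "ae_eq \<Omega> (\<lambda>x. v x $ i) (\<lambda>x. 0)" for i
      unfolding ae_eq_def by eventually_elim simp
    with nz_div weak_pd_zero show False by blast
  qed
  have semi_pos: "0 < H1_seminorm \<Omega> v"
  proof (rule ccontr)
    assume "\<not> 0 < H1_seminorm \<Omega> v"
    then have "a_form \<Omega> v v = 0"
      using a_form_nonneg[of v] by (auto simp: H1_seminorm_eq less_le)
    then have "L2_inner \<Omega> (weak_pd \<Omega> j (\<lambda>x. v x $ i)) (weak_pd \<Omega> j (\<lambda>x. v x $ i)) = 0" for i j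
      unfolding a_form_def by (simp add: sum_nonneg_eq_0_iff sum_nonneg L2_inner_self_nonneg)
    then have "ae_eq \<Omega> (weak_pd \<Omega> i (\<lambda>x. v x $ i)) (\<lambda>x. 0)" for i
      using L2_inner_self_eq_0[OF V0_vecD(3)[OF vV]] by blast
    with nz_div show False by blast
  qed
  have "L2_inner \<Omega> (divergence \<Omega> v) q = L2_inner \<Omega> (\<lambda>x. - q x) q"
    by (rule L2_inner_ae_eq[OF \<Omega>_sets L2(2,1) ae_eq_sym[OF v(2)] ae_eq_refl])
  then have b: "b_form \<Omega> v q = L2_norm \<Omega> q * L2_norm \<Omega> q"
    using norm_sq by (simp add: b_form_def L2_inner_def power2_eq_square)
  have "L2_norm \<Omega> (\<lambda>x. - q x) = L2_norm \<Omega> q"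
    by (simp add: L2_norm_def L2_inner_def)
  then have "\<beta> * H1_seminorm \<Omega> v \<le> L2_norm \<Omega> q"
    using v(3) \<beta> by (simp add: field_simps)
  then have "\<beta> \<le> b_form \<Omega> v q / (H1_seminorm \<Omega> v * L2_norm \<Omega> q)"
    using semi_pos norm_pos by (simp add: b field_simps)
  then show "ereal \<beta> \<le> (SUP v\<in>{v \<in> V_E cs \<Omega> \<T> k. \<not> (AE x in lebesgue_on \<Omega>. v x = 0)}.
          ereal (b_form \<Omega> v q / (H1_seminorm \<Omega> v * L2_norm \<Omega> q)))"
    using v(1) v_nz by (intro SUP_upper2[of v]) auto
qed

end

text \<open>The frontier of the inside of the boundary curve is contained in the curve, a finite union of
  segments.\<close>

lemma polygonal_domain_negligible_boundary:
  assumes "polygonal_domain cs \<Omega>"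
  shows "negligible (closure \<Omega> - \<Omega>)"
proof -
  have \<Omega>: "\<Omega> = inside (polygon_boundary cs)" "open \<Omega>"
    using assms by (auto simp: polygonal_domain_def)
  have "closed (polygon_boundary cs)"
    unfolding polygon_boundary_def polygon_edge_def by (intro closed_UN) auto
  then have "frontier \<Omega> \<subseteq> polygon_boundary cs"
    unfolding \<Omega>(1) by (rule frontier_inside_subset)
  moreover have "negligible (closed_segment a b)" for a b :: pt
    by (simp add: negligible_convex_interior interior_closed_segment_ge2)
  then have "negligible (polygon_boundary cs)"
    unfolding polygon_boundary_def polygon_edge_def by (intro negligible_Union) auto
  ultimately have "negligible (frontier \<Omega>)" using negligible_subset by blast
  then show ?thesis using \<Omega>(2) by (simp add: frontier_def interior_open)
qed

theorem theorem3p7: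
  fixes cs :: "pt list" and \<Omega> :: "pt set" and \<kappa> \<beta> :: real
    and \<M> :: "(pt set set \<times> nat) set"
  assumes "polygonal_domain cs \<Omega>"
    and "\<kappa> > 0"
    and "\<And>\<T> k. (\<T>, k) \<in> \<M> \<Longrightarrow>
           conforming_mesh \<Omega> \<T> \<and> shape_regular \<kappa> \<T> \<and> corner_split \<Omega> \<T> \<and> k \<ge> 4"
    and "0 < \<beta>" and "\<beta> < 1"
    and "\<And>\<T> k. (\<T>, k) \<in> \<M> \<Longrightarrow> infsup_const cs \<Omega> \<T> k \<beta>"
  shows "\<forall>(\<T>, k)\<in>\<M>.
     (\<forall>q\<in>Q_E cs \<Omega> \<T> k. \<exists>v\<in>V_E cs \<Omega> \<T> k.
        ae_eq \<Omega> (divergence \<Omega> v) q \<and> H1_seminorm \<Omega> v \<le> inverse \<beta> * L2_norm \<Omega> q) \<and>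
     (INF q\<in>{q \<in> Q_E cs \<Omega> \<T> k. \<not> ae_eq \<Omega> q (\<lambda>x. 0)}.
        SUP v\<in>{v \<in> V_E cs \<Omega> \<T> k. \<not> (AE x in lebesgue_on \<Omega>. v x = 0)}.
          ereal (b_form \<Omega> v q / (H1_seminorm \<Omega> v * L2_norm \<Omega> q))) \<ge> ereal \<beta>"
proof (rule ballI, rule case_prodI2)
  fix Tk \<T> k assume "Tk \<in> \<M>" "Tk = (\<T>, k)"
  then have Tk: "(\<T>, k) \<in> \<M>" by simp
  have mesh: "conforming_mesh \<Omega> \<T>" "k \<ge> 4" using assms(3)[OF Tk] by auto
  interpret mesh_domain \<Omega> \<T>
  proof
    show "open \<Omega>" "bounded \<Omega>" using assms(1) by (auto simp: polygonal_domain_def)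
    show "negligible (closure \<Omega> - \<Omega>)"
      by (rule polygonal_domain_negligible_boundary[OF assms(1)])
  qed (use mesh(1) in \<open>auto simp: conforming_mesh_def\<close>)
  have lift: "\<exists>v\<in>V_E cs \<Omega> \<T> k.
      ae_eq \<Omega> (divergence \<Omega> v) q \<and> H1_seminorm \<Omega> v \<le> inverse \<beta> * L2_norm \<Omega> q"
    if q: "q \<in> Q_E cs \<Omega> \<T> k" for q
  proof -
    have "q \<in> Q0 cs \<Omega> \<T> k" using q by (simp add: Q_E_def)
    then obtain w where w: "w \<in> V0_vec cs \<Omega> \<T> k" "ae_eq \<Omega> (divergence \<Omega> w) q"
      "H1_norm \<Omega> w \<le> inverse \<beta> * L2_norm \<Omega> q"
      using assms(6)[OF Tk] unfolding infsup_const_def by blast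
    obtain v where v: "v \<in> V_E cs \<Omega> \<T> k" "ae_eq \<Omega> (divergence \<Omega> v) q"
      "H1_seminorm \<Omega> v \<le> H1_seminorm \<Omega> w"
      using divergence_lift_V_E[OF _ q w(1,2)] mesh(2) by auto
    have "H1_seminorm \<Omega> v \<le> inverse \<beta> * L2_norm \<Omega> q"
      using v(3) H1_seminorm_le_norm[of w] w(3) by linarith
    with v show ?thesis by blast
  qed
  then show "(\<forall>q\<in>Q_E cs \<Omega> \<T> k. \<exists>v\<in>V_E cs \<Omega> \<T> k.
        ae_eq \<Omega> (divergence \<Omega> v) q \<and> H1_seminorm \<Omega> v \<le> inverse \<beta> * L2_norm \<Omega> q) \<and>
     (INF q\<in>{q \<in> Q_E cs \<Omega> \<T> k. \<not> ae_eq \<Omega> q (\<lambda>x. 0)}.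
        SUP v\<in>{v \<in> V_E cs \<Omega> \<T> k. \<not> (AE x in lebesgue_on \<Omega>. v x = 0)}.
          ereal (b_form \<Omega> v q / (H1_seminorm \<Omega> v * L2_norm \<Omega> q))) \<ge> ereal \<beta>"
    using inf_sup_lower_bound[OF assms(4)] by blast
qed

end
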